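(* Let $\mathfrak g=A_{2n}^{(2)}$, $n\ge1$, $1\le r\le n$. Let $V=\bigoplus_{k=0}^r\mathrm{Im}(\iota_{\overline\Lambda_k})\subseteq\widehat V^{r,1}=B_A^{2n-r,1}\otimes B_A^{r,1}$, let $b=u\otimes v\in\widehat V^{r,1}$, and write $u_2=u|_{[n+1,2n]}$, $v_2=v|_{[n+1,2n]}$. Then $b\in V$ if and only if 1. $b^{\vee*}=\sigma(b)$; 2. $u_2v_2$ is a tableau; 3. $|u_2|-|v_2|\ge n-r$.
   Context: A column word is a strictly decreasing word in $[2n]$; $B_A^{r,1}$ is the set of column words of length $r$. A semistandard tableau is identified with its column-reading word $c_1c_2\cdots$, $c_j$ the strictly decreasing word of the $j$-th column from the left; for column words $x,y$, "$xy$ is a tableau" means that the top-justified columns $x,y$ form a semistandard tableau. $w|_S$ is the subword of $w$ of letters in $S$; $|w|$ is the length of $w$. $\mathbb P(w)$ is the Schensted tableau of the word $w$ (the unique semistandard tableau Knuth equivalent to $w$; Knuth relations $xzy\sim zxy$ for $x\le y<z$ and $yzx\sim yxz$ for $x<y\le z$). $\sigma:B_A^{2n-r,1}\otimes B_A^{r,1}\to B_A^{r,1}\otimes B_A^{2n-r,1}$ is the local isomorphism: $\sigma(u\otimes v)$ is the unique $v'\otimes u'$ with $\mathbb P(uv)=\mathbb P(v'u')$ (for $r=n$ this is the identity). For a column word $c$, $c^{\vee*}$ is the column word with letter set $\{2n+1-i:i\in[2n],\ i\notin c\}$, and $(u\otimes v)^{\vee*}=u^{\vee*}\otimes v^{\vee*}$.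 Type $A_{2n-1}$ crystal operators: on letters, $f_i^A(i)=i+1$ ($1\le i\le 2n-1$), all other values $\varnothing$ (undefined); on words (tensor products of letters) by the rule $f_i(b_2\otimes b_1)=f_i(b_2)\otimes b_1$ if $\epsilon_i(b_2)\ge\varphi_i(b_1)$, $b_2\otimes f_i(b_1)$ otherwise, and $e_i(b_2\otimes b_1)=e_i(b_2)\otimes b_1$ if $\epsilon_i(b_2)>\varphi_i(b_1)$, $b_2\otimes e_i(b_1)$ otherwise. Virtual $U_q(C_n)$-operators: $e_i=e_{2n-i}^Ae_i^A$, $f_i=f_{2n-i}^Af_i^A$ for $1\le i\le n-1$, $e_n=(e_n^A)^2$, $f_n=(f_n^A)^2$. For $0\le k\le n$ (with $\overline\Lambda_0=0$), $V(\overline\Lambda_k)$ is the set of semistandard tableaux in $[2n]$ with two columns of heights $2n-k$ and $k$ generated by the virtual operators $e_i,f_i$, $1\le i\le n$, from the tableau whose $i$-th row consists of letters $i$. $\iota_{\overline\Lambda_k}:V(\overline\Lambda_k)\to\widehat V^{r,1}$ ($0\le k\le r$) is the embedding sending $b'$ to the unique $b\in\widehat V^{r,1}$ with $\mathbb P(b)=b'$, where $\mathbb P(u\otimes v)=\mathbb P(uv)$. The direct sum is the (disjoint) union of the images. *)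

theory Defs
  imports Main
begin

section \<open>Column words and tableaux\<close>

definition column_words :: "nat \<Rightarrow> nat \<Rightarrow> nat list set" where
  "column_words n r = {c. sorted_wrt (>) c \<and> set c \<subseteq> {1..2 * n} \<and> length c = r}"

text \<open>A column word lists a column from bottom to top, so \<open>rev x ! i\<close> is the entry in row \<open>i\<close>
  (counted from the top, starting at 0) of the column \<open>x\<close>. Either column may be empty.\<close>

definition columns_tableau :: "nat list \<Rightarrow> nat list \<Rightarrow> bool" where
  "columns_tableau x y \<longleftrightarrow>
     sorted_wrt (>) x \<and> sorted_wrt (>) y \<and>
     length y \<le> length x \<and> (\<forall>i<length y. rev x ! i \<le> rev y ! i)"

text \<open>A tableau is represented by its column-reading word. The columns are recovered from the word
  as its maximal strictly decreasing runs, so nothing is lost.\<close>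

definition tableau_word :: "nat list \<Rightarrow> bool" where
  "tableau_word w \<longleftrightarrow>
     (\<exists>cs. w = concat cs \<and> (\<forall>c\<in>set cs. c \<noteq> [] \<and> sorted_wrt (>) c) \<and>
           (\<forall>j. Suc j < length cs \<longrightarrow> columns_tableau (cs ! j) (cs ! Suc j)))"

inductive knuth_step :: "nat list \<Rightarrow> nat list \<Rightarrow> bool" where
  "x \<le> y \<Longrightarrow> y < z \<Longrightarrow> knuth_step (p @ [x, z, y] @ s) (p @ [z, x, y] @ s)"
| "x < y \<Longrightarrow> y \<le> z \<Longrightarrow> knuth_step (p @ [y, z, x] @ s) (p @ [y, x, z] @ s)"

definition schensted :: "nat list \<Rightarrow> nat list" where
  "schensted w = (THE t. tableau_word t \<and> equivclp knuth_step w t)"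

definition restrict_word :: "nat list \<Rightarrow> nat set \<Rightarrow> nat list" where
  "restrict_word w S = filter (\<lambda>x. x \<in> S) w"


section \<open>Tensor products of two columns\<close>

text \<open>A tensor \<open>u \<otimes> v\<close> of two column words is the pair \<open>(u, v)\<close>.\<close>

definition Vhat :: "nat \<Rightarrow> nat \<Rightarrow> (nat list \<times> nat list) set" where
  "Vhat n r = column_words n (2 * n - r) \<times> column_words n r"

definition local_iso :: "nat \<Rightarrow> nat \<Rightarrow> nat list \<times> nat list \<Rightarrow> nat list \<times> nat list" where
  "local_iso n r b =
     (THE b'. b' \<in> column_words n r \<times> column_words n (2 * n - r) \<and>
              schensted (fst b @ snd b) = schensted (fst b' @ snd b'))"

definition dual_star :: "nat \<Rightarrow> nat list \<Rightarrow> nat list" where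
  "dual_star n c = rev (sorted_list_of_set {2 * n + 1 - i | i. i \<in> {1..2 * n} \<and> i \<notin> set c})"

definition dual_star2 :: "nat \<Rightarrow> nat list \<times> nat list \<Rightarrow> nat list \<times> nat list" where
  "dual_star2 n b = (dual_star n (fst b), dual_star n (snd b))"


section \<open>Type A crystal operators on words\<close>

text \<open>Partial operators have option type, with \<open>None\<close> for the undefined value.\<close>

primrec iterate :: "('a \<Rightarrow> 'a option) \<Rightarrow> nat \<Rightarrow> 'a \<Rightarrow> 'a option" where
  "iterate g 0 b = Some b"
| "iterate g (Suc k) b = Option.bind (iterate g k b) g"

text \<open>The function \<open>\<epsilon>\<^sub>i\<close> is \<open>string_length\<close> of \<open>e\<^sub>i\<close>,
  and \<open>\<phi>\<^sub>i\<close> is \<open>string_length\<close> of \<open>f\<^sub>i\<close>.\<close>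

definition string_length :: "('a \<Rightarrow> 'a option) \<Rightarrow> 'a \<Rightarrow> nat" where
  "string_length g b = (GREATEST k. iterate g k b \<noteq> None)"

definition f_letter :: "nat \<Rightarrow> nat \<Rightarrow> nat option" where
  "f_letter i x = (if x = i then Some (i + 1) else None)"

definition e_letter :: "nat \<Rightarrow> nat \<Rightarrow> nat option" where
  "e_letter i x = (if x = i + 1 then Some i else None)"

text \<open>The word \<open>x # w\<close> is the tensor \<open>b\<^sub>2 \<otimes> b\<^sub>1\<close> with \<open>b\<^sub>2 = x\<close> and
  \<open>b\<^sub>1 = w\<close>; the empty word spans the trivial crystal. Since \<open>\<phi>\<^sub>i w\<close> iterates
  \<open>f\<^sub>i\<close> on words of the length of \<open>w\<close>, the recursion runs over the length.\<close>

primrec f_len :: "nat \<Rightarrow> nat \<Rightarrow> nat list \<Rightarrow> nat list option" where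
  "f_len i 0 = (\<lambda>w. None)"
| "f_len i (Suc m) = (\<lambda>b. case b of
      [] \<Rightarrow> None
    | x # w \<Rightarrow>
        if string_length (e_letter i) x \<ge> string_length (f_len i m) w
        then map_option (\<lambda>y. y # w) (f_letter i x)
        else map_option (\<lambda>w'. x # w') (f_len i m w))"

definition f_word :: "nat \<Rightarrow> nat list \<Rightarrow> nat list option" where
  "f_word i w = f_len i (length w) w"

primrec e_word :: "nat \<Rightarrow> nat list \<Rightarrow> nat list option" where
  "e_word i [] = None"
| "e_word i (x # w) =
     (if string_length (e_letter i) x > string_length (f_word i) w
      then map_option (\<lambda>y. y # w) (e_letter i x)
      else map_option (\<lambda>w'. x # w') (e_word i w))"

lemma f_len_length: "f_len i m w = Some w' \<Longrightarrow> length w' = length w"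
proof (induction m arbitrary: w w')
  case 0
  then show ?case by simp
next
  case (Suc m)
  show ?case
  proof (cases w)
    case Nil
    then show ?thesis using Suc.prems by simp
  next
    case (Cons x xs)
    then show ?thesis using Suc.prems by (auto split: if_split_asm dest: Suc.IH)
  qed
qed

lemma iterate_f_len:
  assumes "length w = m"
  shows "iterate (f_word i) k w = iterate (f_len i m) k w \<and>
         (\<forall>w'. iterate (f_len i m) k w = Some w' \<longrightarrow> length w' = m)"
proof (induction k)
  case 0
  then show ?case using assms by simp
next
  case (Suc k)
  show ?case
  proof (cases "iterate (f_len i m) k w")
    case None
    then show ?thesis using Suc by simp
  next
    case (Some w1)
    then have "length w1 = m" and "iterate (f_word i) k w = Some w1" using Suc by auto
    then show ?thesis using Some by (auto simp: f_word_def[of i w1] dest: f_len_length)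
  qed
qed

lemma string_length_f_len: "string_length (f_len i (length w)) w = string_length (f_word i) w"
  unfolding string_length_def using iterate_f_len[OF refl, of i _ w] by simp

lemma f_word_Nil: "f_word i [] = None"
  by (simp add: f_word_def)

lemma f_word_Cons:
  "f_word i (x # w) =
     (if string_length (e_letter i) x \<ge> string_length (f_word i) w
      then map_option (\<lambda>y. y # w) (f_letter i x)
      else map_option (\<lambda>w'. x # w') (f_word i w))"
  by (simp add: f_word_def[of i "x # w"] f_word_def[of i w] string_length_f_len)


section \<open>Virtual crystals\<close>

definition virtual_f :: "nat \<Rightarrow> nat \<Rightarrow> nat list \<Rightarrow> nat list option" where
  "virtual_f n i w =
     (if i = n then Option.bind (f_word n w) (f_word n)
      else Option.bind (f_word i w) (f_word (2 * n - i)))"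

definition virtual_e :: "nat \<Rightarrow> nat \<Rightarrow> nat list \<Rightarrow> nat list option" where
  "virtual_e n i w =
     (if i = n then Option.bind (e_word n w) (e_word n)
      else Option.bind (e_word i w) (e_word (2 * n - i)))"

text \<open>\<open>V_Lambda n k\<close> is \<open>V(\<Lambda>\<^sub>k)\<close>. The generator is the column-reading word of the
  two-column tableau with heights \<open>2n - k\<close> and \<open>k\<close> whose row \<open>i\<close> is filled with \<open>i\<close>.
  The crystal operators preserve the set of tableaux of a given shape.\<close>

inductive_set V_Lambda :: "nat \<Rightarrow> nat \<Rightarrow> nat list set" for n k :: nat where
  highest: "rev [1..<Suc (2 * n - k)] @ rev [1..<Suc k] \<in> V_Lambda n k"
| f_step: "w \<in> V_Lambda n k \<Longrightarrow> i \<in> {1..n} \<Longrightarrow> virtual_f n i w = Some w' \<Longrightarrow> w' \<in> V_Lambda n k"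
| e_step: "w \<in> V_Lambda n k \<Longrightarrow> i \<in> {1..n} \<Longrightarrow> virtual_e n i w = Some w' \<Longrightarrow> w' \<in> V_Lambda n k"

definition iota :: "nat \<Rightarrow> nat \<Rightarrow> nat list \<Rightarrow> nat list \<times> nat list" where
  "iota n r t = (THE b. b \<in> Vhat n r \<and> schensted (fst b @ snd b) = t)"

text \<open>The set underlying the direct sum, for type \<open>A\<^sub>2\<^sub>n\<close> twisted, of the images of the
  \<open>V_Lambda n k\<close>. Different \<open>k\<close> give tableaux of different shapes, so the union is disjoint.\<close>

definition V_sum :: "nat \<Rightarrow> nat \<Rightarrow> (nat list \<times> nat list) set" where
  "V_sum n r = (\<Union>k\<in>{0..r}. iota n r ` V_Lambda n k)"

end

theory Submission
  imports Defs
begin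

text \<open>
  A tensor \<open>u \<otimes> v\<close> is read as a pair \<open>(U, V)\<close> of sets of letters, and every letter as a bracket: an
  opening one if it lies in \<open>U\<close> only, a closing one if it lies in \<open>V\<close> only, and a neutral letter if it
  lies in both or in none. The pair is a tableau iff no closing bracket is unmatched, and the Schensted tableau
  of \<open>uv\<close> arises by moving the unmatched closing letters from \<open>V\<close> to \<open>U\<close>. Moving one of them is called a flip.
  In terms of the walk \<open>height U V\<close>, which goes up at opening and down at closing brackets, a flip happens
  at the step where the walk first reaches its minimum.

  The length of the longest strictly decreasing subsequence with letters below \<open>b\<close> is a Knuth invariant
  (\<open>knuth_eq_dec_below\<close>), and for a pair of columns it is the running maximum of the negated walk, up to
  a summand that counts letters of \<open>U\<close>. Together with the multiplicities of the letters it determines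
  the Knuth class (\<open>knuth_eq_pairI\<close>). Flips therefore stay in the class, and walking up and down
  along flips shows that a class contains exactly one pair for every possible size of \<open>U\<close>
  (\<open>knuth_eq_same_card\<close>, \<open>column_sizes_exist\<close>). This makes \<open>\<sigma>\<close> and the embeddings \<open>\<iota>\<close> computable:
  the first condition says that \<open>uv\<close> is Knuth equivalent to its dual word, i.e. that the pair is
  \<open>self_dual\<close>, and \<open>u \<otimes> v\<close> lies in the image for \<open>k\<close> iff its
  Schensted tableau is in \<open>V(\<Lambda>\<^sub>k)\<close>.

  Duality reverses the bracket word, so it turns flips into reversed flips (\<open>flip_dual\<close>), and self-duality
  says that the matching is symmetric about the middle of the alphabet. In a self-dual pair with
  \<open>card V \<le> card U\<close> all unmatched closing letters are at most \<open>n\<close> (\<open>self_dual_flip_le\<close>); so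
  flips do not touch the letters above \<open>n\<close>, and both of the first two conditions hold for \<open>(u, v)\<close> iff they
  hold for the two columns of its Schensted tableau (\<open>tableau_reduction\<close>). It remains to see that \<open>V(\<Lambda>\<^sub>k)\<close> consists of the
  tableaux of the right shape that satisfy them, called \<open>admissible\<close>.

  The operators \<open>f\<^sub>i\<close> respect Knuth equivalence and duality exchanges \<open>f\<^sub>i\<close> with \<open>f\<^sub>2\<^sub>n\<^sub>-\<^sub>i\<close>, so the virtual
  operators preserve self-duality. For \<open>i \<noteq> n\<close> the two factors act inside the two halves of
  the alphabet, where they preserve tableaux, and \<open>f\<^sub>n\<^sup>2\<close> is only defined when it moves \<open>n\<close> to \<open>n + 1\<close> in
  both columns. Conversely, if some \<open>e\<^sub>i\<close> of type A is defined on an admissible tableau, then so is \<open>e\<^sub>2\<^sub>n\<^sub>-\<^sub>i\<close> by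
  self-duality, hence also a virtual operator; in the case \<open>i = n\<close> the condition on the letters above
  \<open>n\<close> guarantees that \<open>e\<^sub>n\<close> can be applied twice. As the only tableau of a given shape killed by all \<open>e\<^sub>i\<close> is
  the highest one, induction on the sum of the letters leads from every admissible tableau to the generator
  (\<open>admissible_V_Lambda\<close>).

  The third condition follows from the other two: by the second one the walk is minimal on the upper half at
  its left end, and comparing the longest decreasing subsequences of letters at most \<open>n\<close> in the word and in its
  dual bounds its value there (\<open>self_dual_upper_excess\<close>).
\<close>

section \<open>Knuth equivalence and its invariants\<close>

abbreviation knuth_eq :: "nat list \<Rightarrow> nat list \<Rightarrow> bool" (infix "\<approx>" 50) where
  "w \<approx> w' \<equiv> equivclp knuth_step w w'"

lemma knuth_eq_invariant:
  assumes "\<And>w w'. knuth_step w w' \<Longrightarrow> F w = F w'" and "w \<approx> w'"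
  shows "F w = F w'"
  using assms(2) by (induction rule: equivclp_induct) (auto dest: assms(1))

lemma knuth_step_context: "knuth_step w w' \<Longrightarrow> knuth_step (p @ w @ s) (p @ w' @ s)"
proof (induction rule: knuth_step.induct)
  case (1 x y z q t)
  then show ?case using knuth_step.intros(1)[of x y z "p @ q" "t @ s"] by simp
next
  case (2 x y z q t)
  then show ?case using knuth_step.intros(2)[of x y z "p @ q" "t @ s"] by simp
qed

lemma knuth_eq_context: "w \<approx> w' \<Longrightarrow> p @ w @ s \<approx> p @ w' @ s"
proof (induction rule: equivclp_induct)
  case base
  then show ?case by simp
next
  case (step y z)
  then have "p @ y @ s \<approx> p @ z @ s"
    by (blast intro: knuth_step_context r_into_equivclp converse_r_into_equivclp)
  with step.IH show ?case by (rule equivclp_trans)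
qed

lemma knuth_eq_Cons: "w \<approx> w' \<Longrightarrow> x # w \<approx> x # w'"
  using knuth_eq_context[of w w' "[x]" "[]"] by simp

lemma knuth_eq_append: "w \<approx> w' \<Longrightarrow> w @ s \<approx> w' @ s"
  using knuth_eq_context[of w w' "[]" s] by simp

lemma knuth_step_count_list: "knuth_step w w' \<Longrightarrow> count_list w = count_list w'"
  by (induction rule: knuth_step.induct) auto

lemma knuth_eq_count_list: "w \<approx> w' \<Longrightarrow> count_list w = count_list w'"
  by (rule knuth_eq_invariant[OF knuth_step_count_list])

text \<open>The length of the longest strictly decreasing subsequence all of whose letters are below \<open>b\<close>. The bound
  makes the recursion work and records the invariant for all initial segments of the alphabet at once.\<close>

primrec dec_below :: "nat list \<Rightarrow> nat \<Rightarrow> nat" where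
  "dec_below [] b = 0"
| "dec_below (x # w) b = max (dec_below w b) (if x < b then Suc (dec_below w x) else 0)"

text \<open>The length of the longest weakly increasing subsequence all of whose letters are at least \<open>b\<close>.\<close>

primrec inc_from :: "nat list \<Rightarrow> nat \<Rightarrow> nat" where
  "inc_from [] b = 0"
| "inc_from (x # w) b = max (inc_from w b) (if b \<le> x then Suc (inc_from w x) else 0)"

lemma dec_below_mono: "b \<le> c \<Longrightarrow> dec_below w b \<le> dec_below w c"
proof (induction w arbitrary: b c)
  case (Cons x w)
  then have "dec_below w b \<le> dec_below w c" by blast
  with Cons.prems show ?case by auto
qed simp

lemma inc_from_antimono: "b \<le> c \<Longrightarrow> inc_from w c \<le> inc_from w b"
proof (induction w arbitrary: b c)
  case (Cons x w)
  then have "inc_from w c \<le> inc_from w b" by blast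
  with Cons.prems show ?case by auto
qed simp

lemma dec_below_prefix:
  assumes "\<And>b. dec_below w b = dec_below w' b"
  shows "dec_below (p @ w) b = dec_below (p @ w') b"
  using assms by (induction p arbitrary: b) auto

lemma inc_from_prefix:
  assumes "\<And>b. inc_from w b = inc_from w' b"
  shows "inc_from (p @ w) b = inc_from (p @ w') b"
  using assms by (induction p arbitrary: b) auto

text \<open>A decreasing subsequence can use the two swapped letters together only on one side of the relation. There
  one of them may be replaced by the third letter, which lies between them, without changing the length. Since
  prefixes only enter through the recursion, it suffices to compare the words that start with the triple.\<close>

lemma knuth_step_dec_below: "knuth_step w w' \<Longrightarrow> dec_below w = dec_below w'"
proof (induction rule: knuth_step.induct)
  case (1 x y z p s)
  have "dec_below ([x, z, y] @ s) b = dec_below ([z, x, y] @ s) b" for b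
    using 1 dec_below_mono[of x y s] dec_below_mono[of y z s] dec_below_mono[of x b s]
      dec_below_mono[of y b s] dec_below_mono[of z b s]
    by (auto simp: max_def)
  then show ?case using dec_below_prefix by blast
next
  case (2 x y z p s)
  have "dec_below ([y, z, x] @ s) b = dec_below ([y, x, z] @ s) b" for b
    using 2 dec_below_mono[of x y s] dec_below_mono[of y z s] dec_below_mono[of x b s]
      dec_below_mono[of y b s] dec_below_mono[of z b s]
    by (auto simp: max_def)
  then show ?case using dec_below_prefix by blast
qed

lemma knuth_step_inc_from: "knuth_step w w' \<Longrightarrow> inc_from w = inc_from w'"
proof (induction rule: knuth_step.induct)
  case (1 x y z p s)
  have "inc_from ([x, z, y] @ s) b = inc_from ([z, x, y] @ s) b" for b
    using 1 inc_from_antimono[of x y s] inc_from_antimono[of y z s] inc_from_antimono[of b x s]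
      inc_from_antimono[of b y s] inc_from_antimono[of b z s]
    by (auto simp: max_def)
  then show ?case using inc_from_prefix by blast
next
  case (2 x y z p s)
  have "inc_from ([y, z, x] @ s) b = inc_from ([y, x, z] @ s) b" for b
    using 2 inc_from_antimono[of x y s] inc_from_antimono[of y z s] inc_from_antimono[of b x s]
      inc_from_antimono[of b y s] inc_from_antimono[of b z s]
    by (auto simp: max_def)
  then show ?case using inc_from_prefix by blast
qed

lemma knuth_eq_dec_below: "w \<approx> w' \<Longrightarrow> dec_below w = dec_below w'"
  by (rule knuth_eq_invariant[OF knuth_step_dec_below])

lemma knuth_eq_inc_from: "w \<approx> w' \<Longrightarrow> inc_from w = inc_from w'"
  by (rule knuth_eq_invariant[OF knuth_step_inc_from])

section \<open>Crystal operators on words\<close>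

lemma iterate_Suc_left: "iterate g (Suc k) b = Option.bind (g b) (iterate g k)"
proof (induction k)
  case (Suc k)
  have "iterate g (Suc (Suc k)) b = Option.bind (iterate g (Suc k) b) g" by simp
  also have "\<dots> = Option.bind (g b) (iterate g (Suc k))" unfolding Suc by (cases "g b") auto
  finally show ?case .
qed (cases "g b"; simp)

text \<open>The string length is a \<open>GREATEST\<close> and so has no useful unfolding unless the iteration stops. A measure
  that goes down by one at every step provides this.\<close>

lemma string_length_rec:
  assumes m: "\<And>b b'. g b = Some b' \<Longrightarrow> m b = Suc (m b' :: nat)"
  shows "string_length g b = (case g b of None \<Rightarrow> 0 | Some b' \<Rightarrow> Suc (string_length g b'))"
proof -
  have bound: "iterate g k b \<noteq> None \<Longrightarrow> k \<le> m b" for k b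
  proof (induction k arbitrary: b)
    case (Suc k)
    then show ?case using m by (cases "g b") (auto simp: iterate_Suc_left simp del: iterate.simps(2))
  qed simp
  show ?thesis
  proof (cases "g b")
    case None
    have "(GREATEST k. iterate g k b \<noteq> None) = 0"
    proof (rule Greatest_equality)
      fix k assume "iterate g k b \<noteq> None"
      then show "k \<le> 0" using None by (cases k) (auto simp: iterate_Suc_left simp del: iterate.simps(2))
    qed simp
    then show ?thesis using None by (simp add: string_length_def)
  next
    case (Some b')
    let ?K = "GREATEST k. iterate g k b' \<noteq> None"
    have K: "iterate g ?K b' \<noteq> None"
      by (rule GreatestI_nat[of _ 0 "m b'"]) (use bound in auto)
    have le: "iterate g k b' \<noteq> None \<Longrightarrow> k \<le> ?K" for k
      by (rule Greatest_le_nat[of _ _ "m b'"]) (use bound in auto)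
    have "(GREATEST k. iterate g k b \<noteq> None) = Suc ?K"
    proof (rule Greatest_equality)
      show "iterate g (Suc ?K) b \<noteq> None" using K Some
        by (simp add: iterate_Suc_left del: iterate.simps(2))
    next
      fix k assume "iterate g k b \<noteq> None"
      then show "k \<le> Suc ?K" using le Some
        by (cases k) (auto simp: iterate_Suc_left simp del: iterate.simps(2))
    qed
    then show ?thesis using Some by (simp add: string_length_def)
  qed
qed

lemma epsilon_letter: "string_length (e_letter i) x = (if x = Suc i then 1 else 0)"
proof -
  have rec: "string_length (e_letter i) b =
      (case e_letter i b of None \<Rightarrow> 0 | Some b' \<Rightarrow> Suc (string_length (e_letter i) b'))" for b
    by (rule string_length_rec[of _ "\<lambda>x. if x = Suc i then 1 else 0"])
      (auto simp: e_letter_def split: if_splits)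
  show ?thesis by (simp add: rec[of x] rec[of i] e_letter_def)
qed

lemma f_word_count: "f_word i w = Some w' \<Longrightarrow> count_list w i = Suc (count_list w' i)"
  by (induction w arbitrary: w')
    (auto simp: f_word_Nil f_word_Cons f_letter_def split: if_splits)

abbreviation phi :: "nat \<Rightarrow> nat list \<Rightarrow> nat" where "phi i \<equiv> string_length (f_word i)"

lemmas phi_rec = string_length_rec[of "f_word i" "\<lambda>w. count_list w i" for i, OF f_word_count]

lemma phi_eq_0_iff: "phi i w = 0 \<longleftrightarrow> f_word i w = None"
  by (subst phi_rec) (auto split: option.split)

lemma phi_f_word: "f_word i w = Some w' \<Longrightarrow> phi i w = Suc (phi i w')"
  by (subst phi_rec) auto

text \<open>Only the number of free letters \<open>i\<close> in the tail matters, which is why \<open>phi\<close> is carried along in the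
  inductions over words below.\<close>

lemma f_word_Cons_phi:
  "f_word i (x # w) =
     (if x = i \<and> phi i w = 0 then Some (Suc i # w)
      else if x = Suc i \<and> phi i w \<le> 1 then None
      else map_option ((#) x) (f_word i w))"
  by (auto simp: f_word_Cons f_letter_def epsilon_letter phi_eq_0_iff)

lemma e_word_Cons:
  "e_word i (x # w) =
     (if x = Suc i \<and> phi i w = 0 then Some (i # w) else map_option ((#) x) (e_word i w))"
  by (auto simp: e_letter_def epsilon_letter)

lemma phi_Nil: "phi i [] = 0"
  by (simp add: phi_eq_0_iff f_word_Nil)

text \<open>The signature rule read from the left: a letter \<open>i\<close> adds a free \<open>i\<close>, and a letter \<open>i + 1\<close> cancels one of
  the free letters \<open>i\<close> to its right if there is one.\<close>

lemma phi_Cons: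
  "phi i (x # w) = (if x = i then Suc (phi i w) else if x = Suc i then phi i w - 1 else phi i w)"
proof (induction "phi i w" arbitrary: w)
  case 0
  then have "phi i w = 0" "f_word i w = None" using phi_eq_0_iff[of i w] by simp_all
  moreover from this have "phi i (Suc i # w) = 0" by (simp add: phi_eq_0_iff f_word_Cons_phi)
  ultimately show ?case
    by (auto simp: phi_rec[of i "x # w"] f_word_Cons_phi)
next
  case (Suc k)
  then obtain w' where w': "f_word i w = Some w'" using phi_eq_0_iff[of i w] by fastforce
  then have k: "phi i w' = k" using phi_f_word[OF w'] Suc.hyps(2) by simp
  show ?case using w' k Suc.hyps(1)[of w'] Suc.hyps(2)
    by (auto simp: phi_rec[of i "x # w"] f_word_Cons_phi)
qed

declare e_word.simps(2) [simp del]

lemma phi_e_word: "e_word i w = Some w' \<Longrightarrow> phi i w' = Suc (phi i w)"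
  by (induction w arbitrary: w') (auto simp: e_word_Cons phi_Cons split: if_splits)

text \<open>The letter \<open>i + 1\<close> lowered by \<open>e\<^sub>i\<close> becomes the last free letter \<open>i\<close>, which is the one that \<open>f\<^sub>i\<close> raises.\<close>

lemma f_word_e_word: "e_word i w = Some w' \<Longrightarrow> f_word i w' = Some w"
proof (induction w arbitrary: w')
  case (Cons x w)
  then show ?case using phi_e_word[of i w]
    by (auto simp: e_word_Cons f_word_Cons_phi split: if_splits)
qed simp

lemma e_word_sum_list: "e_word i w = Some w' \<Longrightarrow> sum_list w = Suc (sum_list w')"
  by (induction w arbitrary: w') (auto simp: e_word_Cons split: if_splits)

lemma phi_e_word_distant:
  assumes "Suc i < j \<or> Suc j < i" and "e_word j w = Some w'"
  shows "phi i w' = phi i w"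
  using assms(2) by (induction w arbitrary: w')
    (use assms(1) in \<open>auto simp: e_word_Cons phi_Cons split: if_splits\<close>)

lemma phi_f_word_distant:
  assumes "Suc i < j \<or> Suc j < i" and "f_word j w = Some w'"
  shows "phi i w' = phi i w"
  using assms(2) by (induction w arbitrary: w')
    (use assms(1) in \<open>auto simp: f_word_Nil f_word_Cons_phi phi_Cons split: if_splits\<close>)

text \<open>For distant indices, \<open>e\<^sub>i\<close> and \<open>e\<^sub>j\<close> act on different letters and neither changes the free letters that
  decide where the other one acts.\<close>

lemma e_word_commute:
  assumes "Suc i < j \<or> Suc j < i" and "e_word i w = Some w1" and "e_word j w = Some w2"
  shows "\<exists>w'. e_word j w1 = Some w' \<and> e_word i w2 = Some w'"
  using assms(2,3)
proof (induction w arbitrary: w1 w2)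
  case (Cons x w)
  let ?act = "\<lambda>k. x = Suc k \<and> phi k w = 0"
  consider "?act i" | "\<not> ?act i" "?act j" | "\<not> ?act i" "\<not> ?act j" by blast
  then show ?case
  proof cases
    case 1
    then obtain a where "e_word j w = Some a"
      using Cons.prems assms(1) by (auto simp: e_word_Cons split: if_splits)
    then show ?thesis
      using 1 Cons.prems assms(1) phi_e_word_distant[of i j w a] by (auto simp: e_word_Cons)
  next
    case 2
    then obtain a where "e_word i w = Some a"
      using Cons.prems assms(1) by (auto simp: e_word_Cons split: if_splits)
    then show ?thesis
      using 2 Cons.prems assms(1) phi_e_word_distant[of j i w a] by (auto simp: e_word_Cons split: if_splits)
  next
    case 3
    then obtain a b where ab: "e_word i w = Some a" "e_word j w = Some b"
      using Cons.prems by (auto simp: e_word_Cons split: if_splits)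
    from Cons.IH[OF this] obtain c where "e_word j a = Some c" "e_word i b = Some c" by blast
    then show ?thesis
      using 3 ab Cons.prems assms(1) phi_e_word_distant[of i j w b] phi_e_word_distant[of j i w a]
      by (auto simp: e_word_Cons split: if_splits)
  qed
qed (simp)

lemma f_word_commute:
  assumes "Suc i < j \<or> Suc j < i" and "f_word i w = Some w1" and "f_word j w = Some w2"
  shows "\<exists>w'. f_word j w1 = Some w' \<and> f_word i w2 = Some w'"
  using assms(2,3)
proof (induction w arbitrary: w1 w2)
  case (Cons x w)
  let ?act = "\<lambda>k. x = k \<and> phi k w = 0"
  consider "?act i" | "\<not> ?act i" "?act j" | "\<not> ?act i" "\<not> ?act j" by blast
  then show ?case
  proof cases
    case 1
    then obtain a where "f_word j w = Some a"
      using Cons.prems assms(1) by (auto simp: f_word_Cons_phi split: if_splits)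
    then show ?thesis
      using 1 Cons.prems assms(1) phi_f_word_distant[of i j w a] by (auto simp: f_word_Cons_phi)
  next
    case 2
    then obtain a where "f_word i w = Some a"
      using Cons.prems assms(1) by (auto simp: f_word_Cons_phi split: if_splits)
    then show ?thesis
      using 2 Cons.prems assms(1) phi_f_word_distant[of j i w a] by (auto simp: f_word_Cons_phi split: if_splits)
  next
    case 3
    then obtain a b where ab: "f_word i w = Some a" "f_word j w = Some b"
      using Cons.prems by (auto simp: f_word_Cons_phi split: if_splits)
    from Cons.IH[OF this] obtain c where "f_word j a = Some c" "f_word i b = Some c" by blast
    then show ?thesis
      using 3 ab Cons.prems assms(1) phi_f_word_distant[of i j w b] phi_f_word_distant[of j i w a]
      by (auto simp: f_word_Cons_phi split: if_splits)
  qed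
qed (simp add: f_word_Nil)

lemma e_word_commute_None:
  assumes "Suc i < j \<or> Suc j < i" and "e_word i w = Some w1"
  shows "e_word j w1 = None \<longleftrightarrow> e_word j w = None"
  using assms(2)
proof (induction w arbitrary: w1)
  case (Cons x w)
  then show ?case using assms(1) phi_e_word_distant[of j i w]
    by (auto simp: e_word_Cons split: if_splits)
qed simp

lemma knuth_step_phi: "knuth_step w w' \<Longrightarrow> phi i w = phi i w'"
proof (induction rule: knuth_step.induct)
  case (1 x y z p s)
  then show ?case by (induction p) (auto simp: phi_Cons)
next
  case (2 x y z p s)
  then show ?case by (induction p) (auto simp: phi_Cons)
qed

section \<open>Crystal operators respect Knuth equivalence\<close>

lemma knuth_eq_heads:
  assumes "a \<le> b" "b < c"
  shows "a # c # b # t \<approx> c # a # b # t" "c # a # b # t \<approx> a # c # b # t"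
  using knuth_step.intros(1)[of a b c "[]" t] assms by auto

lemma knuth_eq_tails:
  assumes "a < b" "b \<le> c"
  shows "b # a # c # t \<approx> b # c # a # t" "b # c # a # t \<approx> b # a # c # t"
  using knuth_step.intros(2)[of a b c "[]" t] assms by auto

text \<open>Around a triple of letters at most two free letters \<open>i\<close> to the right can be cancelled, so the three cases
  suffice to decide where an operator acts on the triple.\<close>

lemma phi_cases:
  obtains "phi i s = 0" "f_word i s = None"
  | t where "phi i s = 1" "f_word i s = Some t"
  | t where "phi i s > 1" "f_word i s = Some t"
  using phi_eq_0_iff[of i s] by (cases "f_word i s"; cases "phi i s = 1") auto

text \<open>If the swapped letters are not \<open>i\<close> and \<open>i + 1\<close>, the operator acts on the same letter on both sides and the
  order relations of the triple survive. The exception is \<open>i, i + 1, i\<close> against \<open>i + 1, i, i\<close>, where the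
  results may be related by the other Knuth relation.\<close>

lemma f_word_heads:
  assumes "x \<le> y" "y < z"
  shows "rel_option (equivclp knuth_step) (f_word i ([x, z, y] @ s)) (f_word i ([z, x, y] @ s))"
proof (rule phi_cases[of i s])
  assume "phi i s = 0" "f_word i s = None"
  then show ?thesis using assms
    by - (cases "x = i"; cases "x = Suc i"; cases "y = i"; cases "y = Suc i"; cases "z = Suc i";
      simp add: f_word_Cons_phi phi_Cons knuth_eq_heads knuth_eq_tails)
next
  fix t
  assume "phi i s = 1" "f_word i s = Some t"
  then show ?thesis using assms
    by - (cases "x = i"; cases "x = Suc i"; cases "y = i"; cases "y = Suc i"; cases "z = Suc i";
      simp add: f_word_Cons_phi phi_Cons knuth_eq_heads knuth_eq_tails)
next
  fix t
  assume "phi i s > 1" "f_word i s = Some t"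
  then show ?thesis using assms
    by - (cases "x = i"; cases "x = Suc i"; cases "y = i"; cases "y = Suc i"; cases "z = Suc i";
      simp add: f_word_Cons_phi phi_Cons knuth_eq_heads knuth_eq_tails)
qed

lemma f_word_tails:
  assumes "x < y" "y \<le> z"
  shows "rel_option (equivclp knuth_step) (f_word i ([y, z, x] @ s)) (f_word i ([y, x, z] @ s))"
proof (rule phi_cases[of i s])
  assume "phi i s = 0" "f_word i s = None"
  then show ?thesis using assms
    by - (cases "x = i"; cases "y = i"; cases "y = Suc i"; cases "z = i"; cases "z = Suc i";
      simp add: f_word_Cons_phi phi_Cons knuth_eq_heads knuth_eq_tails)
next
  fix t
  assume "phi i s = 1" "f_word i s = Some t"
  then show ?thesis using assms
    by - (cases "x = i"; cases "y = i"; cases "y = Suc i"; cases "z = i"; cases "z = Suc i";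
      simp add: f_word_Cons_phi phi_Cons knuth_eq_heads knuth_eq_tails)
next
  fix t
  assume "phi i s > 1" "f_word i s = Some t"
  then show ?thesis using assms
    by - (cases "x = i"; cases "y = i"; cases "y = Suc i"; cases "z = i"; cases "z = Suc i";
      simp add: f_word_Cons_phi phi_Cons knuth_eq_heads knuth_eq_tails)
qed

lemma e_word_heads:
  assumes "x \<le> y" "y < z"
  shows "rel_option (equivclp knuth_step) (e_word i ([x, z, y] @ s)) (e_word i ([z, x, y] @ s))"
proof (rule phi_cases[of i s])
  assume "phi i s = 0" "f_word i s = None"
  then show ?thesis using assms
    by - (cases "e_word i s"; cases "x = i"; cases "x = Suc i"; cases "y = i"; cases "y = Suc i"; cases "z = Suc i";
      simp add: e_word_Cons phi_Cons knuth_eq_heads knuth_eq_tails)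
next
  fix t
  assume "phi i s = 1" "f_word i s = Some t"
  then show ?thesis using assms
    by - (cases "e_word i s"; cases "x = i"; cases "x = Suc i"; cases "y = i"; cases "y = Suc i"; cases "z = Suc i";
      simp add: e_word_Cons phi_Cons knuth_eq_heads knuth_eq_tails)
next
  fix t
  assume "phi i s > 1" "f_word i s = Some t"
  then show ?thesis using assms
    by - (cases "e_word i s"; cases "x = i"; cases "x = Suc i"; cases "y = i"; cases "y = Suc i"; cases "z = Suc i";
      simp add: e_word_Cons phi_Cons knuth_eq_heads knuth_eq_tails)
qed

lemma e_word_tails:
  assumes "x < y" "y \<le> z"
  shows "rel_option (equivclp knuth_step) (e_word i ([y, z, x] @ s)) (e_word i ([y, x, z] @ s))"
proof (rule phi_cases[of i s])
  assume "phi i s = 0" "f_word i s = None"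
  then show ?thesis using assms
    by - (cases "e_word i s"; cases "x = i"; cases "y = i"; cases "y = Suc i"; cases "z = i"; cases "z = Suc i";
      simp add: e_word_Cons phi_Cons knuth_eq_heads knuth_eq_tails)
next
  fix t
  assume "phi i s = 1" "f_word i s = Some t"
  then show ?thesis using assms
    by - (cases "e_word i s"; cases "x = i"; cases "y = i"; cases "y = Suc i"; cases "z = i"; cases "z = Suc i";
      simp add: e_word_Cons phi_Cons knuth_eq_heads knuth_eq_tails)
next
  fix t
  assume "phi i s > 1" "f_word i s = Some t"
  then show ?thesis using assms
    by - (cases "e_word i s"; cases "x = i"; cases "y = i"; cases "y = Suc i"; cases "z = i"; cases "z = Suc i";
      simp add: e_word_Cons phi_Cons knuth_eq_heads knuth_eq_tails)
qed

lemma f_word_prefix: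
  assumes "rel_option (equivclp knuth_step) (f_word i w) (f_word i w')"
    and "w \<approx> w'" and "phi i w = phi i w'"
  shows "rel_option (equivclp knuth_step) (f_word i (p @ w)) (f_word i (p @ w'))"
proof (induction p)
  case Nil
  then show ?case using assms(1) by simp
next
  case (Cons x p)
  have "p @ w \<approx> p @ w'" using knuth_eq_context[OF assms(2), of p "[]"] by simp
  moreover have "phi i (p @ w) = phi i (p @ w')" using assms(3) by (induction p) (auto simp: phi_Cons)
  ultimately show ?case using Cons
    by (auto simp: f_word_Cons_phi option.rel_map intro!: knuth_eq_Cons elim!: option.rel_mono_strong)
qed

lemma knuth_step_f_word:
  "knuth_step w w' \<Longrightarrow> rel_option (equivclp knuth_step) (f_word i w) (f_word i w')"
proof (induction rule: knuth_step.induct)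
  case (1 x y z p s)
  then show ?case
    using f_word_prefix[OF f_word_heads[of x y z i s] _ knuth_step_phi] knuth_step.intros(1)[of x y z "[]" s]
    by auto
next
  case (2 x y z p s)
  then show ?case
    using f_word_prefix[OF f_word_tails[of x y z i s] _ knuth_step_phi] knuth_step.intros(2)[of x y z "[]" s]
    by auto
qed

lemma knuth_eq_f_word:
  assumes "w \<approx> w'" and "f_word i w = Some v"
  shows "\<exists>v'. f_word i w' = Some v' \<and> v \<approx> v'"
  using assms
proof (induction rule: equivclp_induct)
  case base
  then show ?case by auto
next
  case (step y z)
  then obtain v' where v': "f_word i y = Some v'" "v \<approx> v'" by blast
  from step.hyps(2) have "rel_option (equivclp knuth_step) (f_word i y) (f_word i z)"
  proof
    assume "knuth_step z y"
    from knuth_step_f_word[OF this, of i] show ?thesis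
      by (cases "f_word i y"; cases "f_word i z") (auto intro: equivclp_sym)
  qed (rule knuth_step_f_word)
  then show ?case using v' by (cases "f_word i z") (auto intro: equivclp_trans)
qed

lemma e_word_prefix:
  assumes "rel_option (equivclp knuth_step) (e_word i w) (e_word i w')"
    and "w \<approx> w'" and "phi i w = phi i w'"
  shows "rel_option (equivclp knuth_step) (e_word i (p @ w)) (e_word i (p @ w'))"
proof (induction p)
  case Nil
  then show ?case using assms(1) by simp
next
  case (Cons x p)
  have "p @ w \<approx> p @ w'" using knuth_eq_context[OF assms(2), of p "[]"] by simp
  moreover have "phi i (p @ w) = phi i (p @ w')" using assms(3) by (induction p) (auto simp: phi_Cons)
  ultimately show ?case using Cons
    by (auto simp: e_word_Cons option.rel_map intro!: knuth_eq_Cons elim!: option.rel_mono_strong)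
qed

lemma knuth_step_e_word:
  "knuth_step w w' \<Longrightarrow> rel_option (equivclp knuth_step) (e_word i w) (e_word i w')"
proof (induction rule: knuth_step.induct)
  case (1 x y z p s)
  then show ?case
    using e_word_prefix[OF e_word_heads[of x y z i s] _ knuth_step_phi] knuth_step.intros(1)[of x y z "[]" s]
    by auto
next
  case (2 x y z p s)
  then show ?case
    using e_word_prefix[OF e_word_tails[of x y z i s] _ knuth_step_phi] knuth_step.intros(2)[of x y z "[]" s]
    by auto
qed

lemma knuth_eq_e_word:
  assumes "w \<approx> w'" and "e_word i w = Some v"
  shows "\<exists>v'. e_word i w' = Some v' \<and> v \<approx> v'"
  using assms
proof (induction rule: equivclp_induct)
  case base
  then show ?case by auto
next
  case (step y z)
  then obtain v' where v': "e_word i y = Some v'" "v \<approx> v'" by blast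
  from step.hyps(2) have "rel_option (equivclp knuth_step) (e_word i y) (e_word i z)"
  proof
    assume "knuth_step z y"
    from knuth_step_e_word[OF this, of i] show ?thesis
      by (cases "e_word i y"; cases "e_word i z") (auto intro: equivclp_sym)
  qed (rule knuth_step_e_word)
  then show ?case using v' by (cases "e_word i z") (auto intro: equivclp_trans)
qed

section \<open>Columns as finite sets of letters\<close>

definition col :: "nat set \<Rightarrow> nat list" where
  "col U = rev (sorted_list_of_set U)"

lemma sorted_col: "sorted_wrt (>) (col U)"
  by (simp add: col_def sorted_wrt_rev)

lemma set_col [simp]: "finite U \<Longrightarrow> set (col U) = U"
  by (simp add: col_def)

lemma length_col [simp]: "length (col U) = card U"
  by (simp add: col_def)

text \<open>A strictly decreasing word is determined by its letters.\<close>

lemma col_eqI: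
  assumes "sorted_wrt (>) c" and "set c = U"
  shows "col U = c"
proof -
  have "sorted_wrt (<) (rev c)" using assms(1) by (simp add: sorted_wrt_rev)
  then have "sorted_list_of_set (set (rev c)) = rev c"
    by (intro sorted_list_of_set.idem_if_sorted_distinct) (simp_all only: strict_sorted_iff)
  then show ?thesis using assms(2) by (simp add: col_def)
qed

lemma col_set: "sorted_wrt (>) c \<Longrightarrow> col (set c) = c"
  by (rule col_eqI) auto

lemma col_empty [simp]: "col {} = []"
  by (simp add: col_def)

lemma column_words_eq:
  "column_words n r = {col U | U. U \<subseteq> {1..2 * n} \<and> card U = r}"
proof (intro equalityI subsetI)
  fix c assume "c \<in> column_words n r"
  then show "c \<in> {col U | U. U \<subseteq> {1..2 * n} \<and> card U = r}"
    using col_set[of c] length_col[of "set c"]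
    by (auto simp: column_words_def intro!: exI[of _ "set c"])
next
  fix c assume "c \<in> {col U | U. U \<subseteq> {1..2 * n} \<and> card U = r}"
  then obtain U where "c = col U" "U \<subseteq> {1..2 * n}" "card U = r" by blast
  then show "c \<in> column_words n r"
    using finite_subset[of U "{1..2 * n}"] by (simp add: column_words_def sorted_col)
qed

lemma count_list_col:
  assumes "finite U"
  shows "count_list (col U) a = (if a \<in> U then 1 else 0)"
proof -
  have "count_list c a = (if a \<in> set c then 1 else 0)" if "distinct c" for c
    using that by (induction c) auto
  from this[of "col U"] show ?thesis using assms by (simp add: col_def)
qed

abbreviation pair_word :: "nat set \<Rightarrow> nat set \<Rightarrow> nat list" where
  "pair_word U V \<equiv> col U @ col V"

text \<open>The letters \<open>i\<close> and \<open>i + 1\<close> are neighbours in a column, so the remaining letters can be passed over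
  by \<open>inactive_letters\<close> and an operator of index \<open>i\<close> sees at most four letters of a pair of columns.\<close>

lemma col_split:
  assumes "finite U"
  shows "col U = col (U \<inter> {Suc i<..}) @ (if Suc i \<in> U then [Suc i] else []) @
     (if i \<in> U then [i] else []) @ col (U \<inter> {..<i})"
proof (rule col_eqI)
  show "sorted_wrt (>) (col (U \<inter> {Suc i<..}) @ (if Suc i \<in> U then [Suc i] else []) @
     (if i \<in> U then [i] else []) @ col (U \<inter> {..<i}))"
    using assms by (auto simp: sorted_wrt_append sorted_col)
  show "set (col (U \<inter> {Suc i<..}) @ (if Suc i \<in> U then [Suc i] else []) @
     (if i \<in> U then [i] else []) @ col (U \<inter> {..<i})) = U"
    using assms by (auto simp: not_less_iff_gr_or_eq not_less_eq less_Suc_eq)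
qed

lemma inactive_letters:
  assumes "i \<notin> set p" "Suc i \<notin> set p"
  shows "f_word i (p @ w) = map_option ((@) p) (f_word i w)"
    and "e_word i (p @ w) = map_option ((@) p) (e_word i w)"
    and "phi i (p @ w) = phi i w"
proof -
  show "f_word i (p @ w) = map_option ((@) p) (f_word i w)"
    using assms by (induction p; cases "f_word i w") (auto simp: f_word_Cons_phi)
  show "e_word i (p @ w) = map_option ((@) p) (e_word i w)"
    using assms by (induction p; cases "e_word i w") (auto simp: e_word_Cons)
  show "phi i (p @ w) = phi i w"
    using assms by (induction p) (auto simp: phi_Cons)
qed

text \<open>The operator \<open>f\<^sub>i\<close> in terms of the letters of two columns. Within a column, \<open>i + 1\<close> stands
  to the left of \<open>i\<close> and cancels it, so a column matters only if it has exactly one of the two letters. If both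
  columns have a free \<open>i\<close>, the one in the right column is raised.\<close>

definition f_pair :: "nat \<Rightarrow> nat set \<times> nat set \<Rightarrow> (nat set \<times> nat set) option" where
  "f_pair i = (\<lambda>(U, V).
     if i \<in> V \<and> Suc i \<notin> V then
       (if Suc i \<in> U \<and> i \<notin> U then None else Some (U, insert (Suc i) (V - {i})))
     else if i \<in> U \<and> Suc i \<notin> U then Some (insert (Suc i) (U - {i}), V)
     else None)"

text \<open>If both columns have a free \<open>i + 1\<close>, the one in the left column is lowered.\<close>

definition e_pair :: "nat \<Rightarrow> nat set \<times> nat set \<Rightarrow> (nat set \<times> nat set) option" where
  "e_pair i = (\<lambda>(U, V).
     if Suc i \<in> U \<and> i \<notin> U then
       (if i \<in> V \<and> Suc i \<notin> V then None else Some (insert i (U - {Suc i}), V))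
     else if Suc i \<in> V \<and> i \<notin> V then Some (U, insert i (V - {Suc i}))
     else None)"

lemma col_shift:
  assumes "finite U" 
  shows "i \<in> U \<Longrightarrow> Suc i \<notin> U \<Longrightarrow>
      col (insert (Suc i) (U - {i})) = col (U \<inter> {Suc i<..}) @ [Suc i] @ col (U \<inter> {..<i})"
    and "Suc i \<in> U \<Longrightarrow> i \<notin> U \<Longrightarrow>
      col (insert i (U - {Suc i})) = col (U \<inter> {Suc i<..}) @ [i] @ col (U \<inter> {..<i})"
proof -
  have "insert (Suc i) (U - {i}) \<inter> {Suc i<..} = U \<inter> {Suc i<..}"
    "insert (Suc i) (U - {i}) \<inter> {..<i} = U \<inter> {..<i}"
    "insert i (U - {Suc i}) \<inter> {Suc i<..} = U \<inter> {Suc i<..}"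
    "insert i (U - {Suc i}) \<inter> {..<i} = U \<inter> {..<i}" by auto
  then show "i \<in> U \<Longrightarrow> Suc i \<notin> U \<Longrightarrow>
      col (insert (Suc i) (U - {i})) = col (U \<inter> {Suc i<..}) @ [Suc i] @ col (U \<inter> {..<i})"
    and "Suc i \<in> U \<Longrightarrow> i \<notin> U \<Longrightarrow>
      col (insert i (U - {Suc i})) = col (U \<inter> {Suc i<..}) @ [i] @ col (U \<inter> {..<i})"
    using col_split[of "insert (Suc i) (U - {i})" i] col_split[of "insert i (U - {Suc i})" i] assms
    by simp_all
qed

text \<open>Removing the letters other than \<open>i\<close> and \<open>i + 1\<close> leaves a word with at most four letters, and the sixteen
  cases are computed.\<close>

lemma word_pair:
  assumes "finite U" "finite V"
  shows f_word_pair: "f_word i (pair_word U V) = map_option (\<lambda>(U, V). pair_word U V) (f_pair i (U, V))"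
    and e_word_pair: "e_word i (pair_word U V) = map_option (\<lambda>(U, V). pair_word U V) (e_pair i (U, V))"
proof -
  define A B A' B' where "A = col (U \<inter> {Suc i<..})" and "B = col (U \<inter> {..<i})"
    and "A' = col (V \<inter> {Suc i<..})" and "B' = col (V \<inter> {..<i})"
  note defs = A_def[symmetric] B_def[symmetric] A'_def[symmetric] B'_def[symmetric]
  have free: "i \<notin> set A" "Suc i \<notin> set A" "i \<notin> set B" "Suc i \<notin> set B"
    "i \<notin> set A'" "Suc i \<notin> set A'" "i \<notin> set B'" "Suc i \<notin> set B'"
    using assms by (auto simp: A_def B_def A'_def B'_def)
  have last: "phi i B' = 0" "f_word i B' = None" "e_word i B' = None"
    using inactive_letters[OF free(7,8), of "[]"] by (simp_all add: phi_Nil f_word_Nil)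
  note U = col_split[OF assms(1), of i, unfolded defs] col_shift[OF assms(1), of i, unfolded defs]
  note V = col_split[OF assms(2), of i, unfolded defs] col_shift[OF assms(2), of i, unfolded defs]
  note simps = f_pair_def e_pair_def f_word_Cons_phi e_word_Cons phi_Cons inactive_letters free last
  show "f_word i (pair_word U V) = map_option (\<lambda>(U, V). pair_word U V) (f_pair i (U, V))"
    by (cases "i \<in> U"; cases "Suc i \<in> U"; cases "i \<in> V"; cases "Suc i \<in> V")
      (simp_all add: simps U(2-) V(2-), (simp_all add: U V simps)?)
  show "e_word i (pair_word U V) = map_option (\<lambda>(U, V). pair_word U V) (e_pair i (U, V))"
    by (cases "i \<in> U"; cases "Suc i \<in> U"; cases "i \<in> V"; cases "Suc i \<in> V")
      (simp_all add: simps U(2-) V(2-), (simp_all add: U V simps)?)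
qed

section \<open>Bracket walks and longest decreasing subsequences\<close>

definition below :: "nat set \<Rightarrow> nat \<Rightarrow> nat" where
  "below U b = card (U \<inter> {..<b})"

text \<open>The walk of the bracket word: the value at \<open>b\<close> is the number of opening minus the number of closing
  brackets among the letters below \<open>b\<close>.\<close>

definition height :: "nat set \<Rightarrow> nat set \<Rightarrow> nat \<Rightarrow> int" where
  "height U V b = int (below U b) - int (below V b)"

lemma below_0 [simp]: "below U 0 = 0"
  by (simp add: below_def)

lemma below_Suc: "below U (Suc b) = (if b \<in> U then Suc (below U b) else below U b)"
  by (simp add: below_def lessThan_Suc Int_insert_right)

lemma below_mono: "a \<le> b \<Longrightarrow> below U a \<le> below U b"
  unfolding below_def by (rule card_mono) auto

lemma below_large: "U \<subseteq> {..<b} \<Longrightarrow> below U b = card U"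
  by (simp add: below_def Int_absorb2)

lemma below_le_card: "finite U \<Longrightarrow> below U b \<le> card U"
  unfolding below_def by (rule card_mono) auto

lemma below_insert:
  "finite U \<Longrightarrow> c \<notin> U \<Longrightarrow> below (insert c U) b = below U b + (if c < b then 1 else 0)"
  by (simp add: below_def Int_insert_left)

lemma below_remove:
  assumes "finite U" "c \<in> U"
  shows "below U b = below (U - {c}) b + (if c < b then 1 else 0)"
  using below_insert[of "U - {c}" c b] assms by (simp add: insert_absorb)

lemma below_inject:
  assumes "\<And>b. below U b = below V b"
  shows "U = V"
proof (rule set_eqI)
  fix x
  show "x \<in> U \<longleftrightarrow> x \<in> V" using assms[of x] assms[of "Suc x"] by (auto simp: below_Suc split: if_splits)
qed

lemma height_0 [simp]: "height U V 0 = 0"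
  by (simp add: height_def)

lemma height_Suc: "height U V (Suc b) =
    height U V b + (if b \<in> U then 1 else 0) - (if b \<in> V then 1 else 0)"
  by (simp add: height_def below_Suc)

lemma height_large: "U \<union> V \<subseteq> {..<b} \<Longrightarrow> height U V b = int (card U) - int (card V)"
  by (simp add: height_def below_large)

lemma below_interval:
  assumes "m \<le> b"
  shows "card (U \<inter> {m..<b}) + below U m = below U b"
proof -
  have "U \<inter> {..<b} = (U \<inter> {m..<b}) \<union> (U \<inter> {..<m})" using assms by auto
  then have "below U b = card ((U \<inter> {m..<b}) \<union> (U \<inter> {..<m}))" by (simp add: below_def)
  also have "\<dots> = card (U \<inter> {m..<b}) + below U m"
    unfolding below_def by (rule card_Un_disjoint) auto
  finally show ?thesis by simp
qed

text \<open>A decreasing subsequence of a column followed by a word consists of the letters of the column down to some \<open>m\<close>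
  and a subsequence of the word with letters below \<open>m\<close>.\<close>

lemma dec_below_append_ge:
  assumes "sorted_wrt (>) c" "m \<le> b"
  shows "card (set c \<inter> {m..<b}) + dec_below w m \<le> dec_below (c @ w) b"
  using assms
proof (induction c arbitrary: b)
  case Nil
  then show ?case by (simp add: dec_below_mono)
next
  case (Cons x c)
  show ?case
  proof (cases "x \<in> {m..<b}")
    case True
    have "set c \<inter> {m..<b} = set c \<inter> {m..<x}" using Cons.prems True by auto
    then have "card (set (x # c) \<inter> {m..<b}) = Suc (card (set c \<inter> {m..<x}))"
      using Cons.prems True by (simp add: Int_insert_left)
    then show ?thesis using Cons.IH[of x] Cons.prems True by auto
  next
    case False
    then show ?thesis using Cons.IH[of b] Cons.prems
      by (auto simp: Int_insert_left le_max_iff_disj)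
  qed
qed

lemma dec_below_append_le:
  assumes "sorted_wrt (>) c"
  shows "\<exists>m\<le>b. dec_below (c @ w) b \<le> card (set c \<inter> {m..<b}) + dec_below w m"
  using assms
proof (induction c arbitrary: b)
  case Nil
  then show ?case by auto
next
  case (Cons x c)
  have IH: "\<exists>m\<le>b. dec_below (c @ w) b \<le> card (set c \<inter> {m..<b}) + dec_below w m" for b
    using Cons by simp
  consider "dec_below ((x # c) @ w) b = dec_below (c @ w) b"
    | "x < b" "dec_below ((x # c) @ w) b = Suc (dec_below (c @ w) x)"
    by (cases "x < b \<and> dec_below (c @ w) b \<le> Suc (dec_below (c @ w) x)") (auto simp: max_def)
  then show ?case
  proof cases
    case 1
    obtain m where m: "m \<le> b" "dec_below (c @ w) b \<le> card (set c \<inter> {m..<b}) + dec_below w m"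
      using IH by blast
    have "card (set c \<inter> {m..<b}) \<le> card (set (x # c) \<inter> {m..<b})" by (rule card_mono) auto
    with m 1 show ?thesis by (intro exI[of _ m]) auto
  next
    case 2
    obtain m where m: "m \<le> x" "dec_below (c @ w) x \<le> card (set c \<inter> {m..<x}) + dec_below w m"
      using IH by blast
    have "set c \<inter> {m..<b} = set c \<inter> {m..<x}" using Cons.prems 2 by auto
    then have "card (set (x # c) \<inter> {m..<b}) = Suc (card (set c \<inter> {m..<x}))"
      using Cons.prems 2 m by (simp add: Int_insert_left)
    then show ?thesis using m 2 by (intro exI[of _ m]) auto
  qed
qed

lemma dec_below_col:
  assumes "finite V"
  shows "dec_below (col V) b = below V b"
proof (rule antisym)
  show "dec_below (col V) b \<le> below V b"
    using dec_below_append_le[OF sorted_col[of V], of b "[]"] below_interval[of _ b V] assms by force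
  show "below V b \<le> dec_below (col V) b"
    using dec_below_append_ge[OF sorted_col[of V], of 0 b "[]"] below_interval[of 0 b V] assms by simp
qed

text \<open>With \<open>dec_below_pair_ex\<close>, the invariant of a pair of columns is the number of letters of \<open>U\<close> below
  \<open>b\<close> plus the maximum of the negated walk up to \<open>b\<close>.\<close>

lemma dec_below_pair_ge:
  assumes "finite U" "finite V" "m \<le> b"
  shows "int (below U b) - height U V m \<le> int (dec_below (pair_word U V) b)"
  using dec_below_append_ge[OF sorted_col[of U] assms(3), of "col V"] below_interval[OF assms(3), of U] assms
  by (simp add: height_def dec_below_col)

lemma dec_below_pair_ex:
  assumes "finite U" "finite V"
  shows "\<exists>m\<le>b. int (dec_below (pair_word U V) b) = int (below U b) - height U V m"
proof -
  obtain m where m: "m \<le> b" "dec_below (pair_word U V) b \<le> card (U \<inter> {m..<b}) + below V m"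
    using dec_below_append_le[OF sorted_col[of U], of b "col V"] assms by (auto simp: dec_below_col)
  then show ?thesis using dec_below_pair_ge[OF assms m(1)] below_interval[OF m(1), of U]
    by (intro exI[of _ m]) (auto simp: height_def)
qed

text \<open>The tableau condition in counting form: no closing bracket is unmatched.\<close>

definition dominates :: "nat set \<Rightarrow> nat set \<Rightarrow> bool" where
  "dominates U V \<longleftrightarrow> (\<forall>b. below V b \<le> below U b)"

lemma dominates_height: "dominates U V \<longleftrightarrow> (\<forall>b. 0 \<le> height U V b)"
  by (simp add: dominates_def height_def)

lemma nth_less_iff:
  assumes "sorted_wrt (<) xs" "i < length xs"
  shows "xs ! i < b \<longleftrightarrow> i < below (set xs) b"
  using assms
proof (induction xs arbitrary: i)
  case (Cons x xs)
  have x: "x \<notin> set xs" using Cons.prems by auto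
  show ?case
  proof (cases "x < b")
    case True
    then show ?thesis using Cons x by (cases i) (auto simp: below_insert)
  next
    case False
    then have "set (x # xs) \<inter> {..<b} = {}" using Cons.prems by auto
    moreover have "\<not> (x # xs) ! i < b" using Cons.prems False
      by (cases i) (simp_all, meson less_trans not_less nth_mem order_less_le_trans)
    ultimately show ?thesis by (simp add: below_def)
  qed
qed simp

text \<open>The entry in row \<open>i\<close> is below \<open>b\<close> iff more than \<open>i\<close> letters of the column are, so comparing the
  columns row by row is the same as comparing the numbers of letters below each bound.\<close>

lemma columns_tableau_col:
  assumes "finite U" "finite V"
  shows "columns_tableau (col U) (col V) \<longleftrightarrow> dominates U V"
proof -
  let ?x = "sorted_list_of_set U" and ?y = "sorted_list_of_set V"
  have x: "i < card U \<Longrightarrow> ?x ! i < b \<longleftrightarrow> i < below U b" for i b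
    using nth_less_iff[of ?x i b] assms by simp
  have y: "i < card V \<Longrightarrow> ?y ! i < b \<longleftrightarrow> i < below V b" for i b
    using nth_less_iff[of ?y i b] assms by simp
  have eq: "columns_tableau (col U) (col V) \<longleftrightarrow> card V \<le> card U \<and> (\<forall>i<card V. ?x ! i \<le> ?y ! i)"
    by (simp add: columns_tableau_def sorted_col) (simp add: col_def)
  show ?thesis
  proof
    assume "columns_tableau (col U) (col V)"
    then have *: "card V \<le> card U" "\<And>i. i < card V \<Longrightarrow> ?x ! i \<le> ?y ! i" using eq by auto
    have "below V b \<le> below U b" for b
    proof (cases "below V b")
      case (Suc q)
      then have "q < card V" using below_le_card[OF assms(2), of b] by simp
      with * x[of q b] y[of q b] Suc show ?thesis by fastforce
    qed simp
    then show "dominates U V" by (simp add: dominates_def)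
  next
    assume D: "dominates U V"
    obtain b where "U \<union> V \<subseteq> {..<b}" using finite_nat_set_iff_bounded[of "U \<union> V"] assms by auto
    then have card: "card V \<le> card U" using D by (metis dominates_def below_large le_sup_iff)
    moreover have "?x ! i \<le> ?y ! i" if "i < card V" for i
    proof -
      have "i < below V (Suc (?y ! i))" using y[of i "Suc (?y ! i)"] that by simp
      also have "\<dots> \<le> below U (Suc (?y ! i))" using D by (simp add: dominates_def)
      finally show ?thesis using x[of i "Suc (?y ! i)"] that card by simp
    qed
    ultimately show "columns_tableau (col U) (col V)" using eq by simp
  qed
qed

lemma dec_below_dominates:
  assumes "finite U" "finite V" "dominates U V"
  shows "dec_below (pair_word U V) b = below U b"
proof -
  obtain m where "int (dec_below (pair_word U V) b) = int (below U b) - height U V m"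
    using dec_below_pair_ex[OF assms(1,2)] by blast
  moreover have "0 \<le> height U V m" using assms(3) by (simp add: dominates_height)
  ultimately show ?thesis using dec_below_pair_ge[OF assms(1,2), of 0 b] by simp
qed

text \<open>The walk of a tableau is nonnegative, so the invariant counts the letters of the first column below each bound.
  This gives the first column, and the multiplicities of the letters give the second.\<close>

lemma tableau_unique:
  assumes "finite X" "finite Y" "finite X'" "finite Y'" "dominates X Y" "dominates X' Y'"
    and dec: "dec_below (pair_word X Y) = dec_below (pair_word X' Y')"
    and cnt: "count_list (pair_word X Y) = count_list (pair_word X' Y')"
  shows "X = X' \<and> Y = Y'"
proof
  show X: "X = X'" using assms by (intro below_inject) (metis dec_below_dominates)
  show "Y = Y'"
  proof (rule set_eqI)
    fix a
    show "a \<in> Y \<longleftrightarrow> a \<in> Y'" using fun_cong[OF cnt, of a] X assms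
      by (simp add: count_list_col split: if_splits)
  qed
qed

section \<open>Column insertion and the classes of pairs of columns\<close>

text \<open>The bumped letter \<open>y\<close> is the smallest one of the column that is at least \<open>x\<close>. First \<open>x\<close> moves to the right
  past the letters above \<open>y\<close>, then \<open>y\<close> moves to the end past the letters below \<open>x\<close>.\<close>

lemma bump_knuth_eq:
  assumes "sorted_wrt (>) (p @ y # q)" "\<forall>z\<in>set q. z < x" "x \<le> y"
  shows "x # p @ y # q \<approx> p @ x # q @ [y]"
proof -
  have left: "\<lbrakk>sorted_wrt (>) (p @ [y]); x \<le> y\<rbrakk> \<Longrightarrow> x # p @ y # s \<approx> p @ x # y # s" for p s
  proof (induction p arbitrary: s)
    case (Cons a p)
    have "x # a # p @ y # s \<approx> a # x # p @ y # s"
      using Cons.prems by (cases p) (auto intro!: knuth_eq_heads(1))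
    also have "a # x # p @ y # s \<approx> a # p @ x # y # s"
      using Cons by (intro knuth_eq_Cons) auto
    finally show ?case by simp
  qed simp
  have right: "\<lbrakk>sorted_wrt (>) (y # q); \<forall>z\<in>set q. z < x; x \<le> y\<rbrakk> \<Longrightarrow> x # y # q \<approx> x # q @ [y]" for q
  proof (induction q arbitrary: x)
    case (Cons b q)
    have "x # y # b # q \<approx> x # b # y # q" using Cons.prems by (auto intro!: knuth_eq_tails(2))
    also have "x # b # y # q \<approx> x # b # q @ [y]"
      using Cons.prems by (intro knuth_eq_Cons Cons.IH) auto
    finally show ?case by simp
  qed simp
  have "x # p @ y # q \<approx> p @ x # y # q" using left[of p q] assms by (simp add: sorted_wrt_append)
  also have "p @ x # y # q \<approx> p @ x # q @ [y]"
    using knuth_eq_context[OF right[of q], of p "[]"] assms by (simp add: sorted_wrt_append)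
  finally show ?thesis .
qed

lemma bump_col:
  assumes "finite X" "y \<in> X" "x \<le> y" "\<forall>z\<in>X. x \<le> z \<longrightarrow> y \<le> z"
  shows "x # col X \<approx> col (insert x (X - {y})) @ [y]"
proof -
  let ?p = "col (X \<inter> {y<..})" and ?q = "col (X \<inter> {..<x})"
  have X: "col X = ?p @ y # ?q"
    using assms by (intro col_eqI) (auto simp: sorted_wrt_append sorted_col)
  have X': "col (insert x (X - {y})) = ?p @ x # ?q"
    using assms by (intro col_eqI) (auto simp: sorted_wrt_append sorted_col)
  have "x # ?p @ y # ?q \<approx> ?p @ x # ?q @ [y]"
    using assms sorted_col[of X] by (intro bump_knuth_eq) (auto simp: X)
  then show ?thesis by (simp add: X X')
qed

text \<open>The letters of \<open>u\<close> are inserted into the column of \<open>V\<close> from right to left, in increasing order. Bumped letters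
  are then increasing too and simply pile up at the bottom of the second column. The last clause of the
  statement is what makes the induction work: a letter that can still be bumped exceeds all bumped letters.\<close>

lemma column_insertion:
  assumes "sorted_wrt (>) u" "finite V"
  shows "\<exists>X Y. finite X \<and> finite Y \<and> dominates X Y \<and> u @ col V \<approx> pair_word X Y \<and>
    X \<union> Y = set u \<union> V \<and> (\<forall>z\<in>X. (\<forall>a\<in>set u. a < z) \<longrightarrow> (\<forall>y\<in>Y. y < z))"
  using assms(1)
proof (induction u)
  case Nil
  show ?case using assms(2) by (intro exI[of _ V] exI[of _ "{}"]) (auto simp: dominates_def below_def)
next
  case (Cons x u)
  then obtain X Y where XY: "finite X" "finite Y" "dominates X Y" "u @ col V \<approx> pair_word X Y"
    "X \<union> Y = set u \<union> V" and sep: "\<And>z y. z \<in> X \<Longrightarrow> \<forall>a\<in>set u. a < z \<Longrightarrow> y \<in> Y \<Longrightarrow> y < z"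
    by (metis sorted_wrt.simps(2))
  have xu: "\<forall>a\<in>set u. a < x" using Cons.prems by auto
  have eq: "(x # u) @ col V \<approx> (x # col X) @ col Y" using knuth_eq_Cons[OF XY(4)] by simp
  show ?case
  proof (cases "\<exists>z\<in>X. x \<le> z")
    case False
    then have below: "\<forall>z\<in>X. z < x" by auto
    then have "col (insert x X) = x # col X"
      using XY(1) by (intro col_eqI) (auto simp: sorted_col)
    moreover have "dominates (insert x X) Y"
      unfolding dominates_def
    proof
      fix b
      have "below Y b \<le> below X b" using XY(3) by (simp add: dominates_def)
      also have "\<dots> \<le> below (insert x X) b" using below below_insert[OF XY(1), of x b] by auto
      finally show "below Y b \<le> below (insert x X) b" .
    qed
    moreover have "insert x X \<union> Y = set (x # u) \<union> V" using XY(5) by auto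
    moreover have "\<forall>z\<in>insert x X. (\<forall>a\<in>set (x # u). a < z) \<longrightarrow> (\<forall>y\<in>Y. y < z)"
      using below by fastforce
    moreover have "finite (insert x X)" using XY(1) by simp
    ultimately show ?thesis using XY(2) eq by metis
  next
    case True
    define y where "y = (LEAST z. z \<in> X \<and> x \<le> z)"
    have y: "y \<in> X" "x \<le> y" using LeastI_ex[of "\<lambda>z. z \<in> X \<and> x \<le> z"] True by (auto simp: y_def)
    have least: "\<forall>z\<in>X. x \<le> z \<longrightarrow> y \<le> z" by (auto simp: y_def intro: Least_le)
    have yY: "\<forall>y'\<in>Y. y' < y" using sep[OF y(1)] xu y(2) less_le_trans by blast
    let ?X = "insert x (X - {y})" and ?Y = "insert y Y"
    have colY: "col ?Y = y # col Y"
      using XY(2) yY by (intro col_eqI) (auto simp: sorted_col)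
    have "x # col X \<approx> col ?X @ [y]" by (rule bump_col[OF XY(1) y least])
    then have "(x # col X) @ col Y \<approx> pair_word ?X ?Y"
      using knuth_eq_append[of "x # col X" "col ?X @ [y]" "col Y"] colY by simp
    with eq have "(x # u) @ col V \<approx> pair_word ?X ?Y" by (rule equivclp_trans)
    moreover have "dominates ?X ?Y"
      unfolding dominates_def
    proof
      fix b
      have yn: "y \<notin> Y" using yY by auto
      have bX: "below X b \<le> below ?X b"
      proof (cases "x = y")
        case False
        then have "x \<notin> X" using least y by force
        then show ?thesis using below_insert[of "X - {y}" x b] below_remove[OF XY(1) y(1), of b] XY(1) y(2)
          by auto
      qed (use y in \<open>simp add: insert_absorb\<close>)
      show "below ?Y b \<le> below ?X b"
      proof (cases "y < b")
        case False
        then show ?thesis using bX XY(3) below_insert[OF XY(2) yn, of b]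
          by (auto simp: dominates_def intro: le_trans)
      next
        case True
        have "below Y b = below Y y" using yY True unfolding below_def by (intro arg_cong[where f = card]) auto
        also have "\<dots> \<le> below X y" using XY(3) by (simp add: dominates_def)
        finally have "Suc (below Y b) \<le> below X (Suc y)" using y(1) by (simp add: below_Suc)
        also have "\<dots> \<le> below X b" using True by (intro below_mono) auto
        finally show ?thesis using bX below_insert[OF XY(2) yn, of b] True by simp
      qed
    qed
    moreover have "\<forall>z\<in>?X. (\<forall>a\<in>set (x # u). a < z) \<longrightarrow> (\<forall>y'\<in>?Y. y' < z)"
    proof (intro ballI impI)
      fix z y' assume z: "z \<in> ?X" "\<forall>a\<in>set (x # u). a < z" and y': "y' \<in> ?Y"
      then have "z \<in> X" "z \<noteq> y" "x \<le> z" by auto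
      with least have "y < z" by (simp add: le_neq_implies_less)
      with y' yY show "y' < z" by auto
    qed
    moreover have "?X \<union> ?Y = set (x # u) \<union> V" using XY(5) y(1) by auto
    moreover have "finite ?X" "finite ?Y" using XY(1,2) by simp_all
    ultimately show ?thesis by blast
  qed
qed

lemma tableau_exists:
  assumes "finite U" "finite V"
  obtains X Y where "finite X" "finite Y" "dominates X Y" "pair_word U V \<approx> pair_word X Y" "X \<union> Y = U \<union> V"
proof -
  from column_insertion[OF sorted_col[of U] assms(2)] obtain X Y
    where "finite X" "finite Y" "dominates X Y" "pair_word U V \<approx> pair_word X Y" "X \<union> Y = set (col U) \<union> V"
    by blast
  then show thesis by (intro that[of X Y]) (simp_all only: set_col[OF assms(1)])
qed

text \<open>Both words are equivalent to tableaux, and equal invariants force these to be the same.\<close>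

lemma knuth_eq_pairI:
  assumes "finite U" "finite V" "finite U'" "finite V'"
    and "dec_below (pair_word U V) = dec_below (pair_word U' V')"
    and "count_list (pair_word U V) = count_list (pair_word U' V')"
  shows "pair_word U V \<approx> pair_word U' V'"
proof -
  obtain X Y where XY: "finite X" "finite Y" "dominates X Y" "pair_word U V \<approx> pair_word X Y"
    by (rule tableau_exists[OF assms(1,2)])
  obtain X' Y' where XY': "finite X'" "finite Y'" "dominates X' Y'" "pair_word U' V' \<approx> pair_word X' Y'"
    by (rule tableau_exists[OF assms(3,4)])
  have "dec_below (pair_word X Y) = dec_below (pair_word X' Y')"
    by (rule trans[OF trans[OF knuth_eq_dec_below[OF XY(4), symmetric] assms(5)] knuth_eq_dec_below[OF XY'(4)]])
  moreover have "count_list (pair_word X Y) = count_list (pair_word X' Y')"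
    by (rule trans[OF trans[OF knuth_eq_count_list[OF XY(4), symmetric] assms(6)] knuth_eq_count_list[OF XY'(4)]])
  ultimately have "X = X' \<and> Y = Y'"
    by (rule tableau_unique[OF XY(1,2) XY'(1,2) XY(3) XY'(3)])
  with XY'(4) have "pair_word U' V' \<approx> pair_word X Y" by simp
  with XY(4) show ?thesis by (rule equivclp_trans[OF _ equivclp_sym])
qed

lemma tableau_unique_knuth:
  assumes "finite X" "finite Y" "finite X'" "finite Y'" "dominates X Y" "dominates X' Y'"
    and "pair_word X Y \<approx> pair_word X' Y'"
  shows "X = X' \<and> Y = Y'"
  by (rule tableau_unique[OF assms(1-6) knuth_eq_dec_below[OF assms(7)] knuth_eq_count_list[OF assms(7)]])

section \<open>The Schensted tableau of a pair of columns\<close>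

lemma inc_from_column:
  assumes "sorted_wrt (>) c"
  shows "inc_from (c @ w) b \<le> Suc (inc_from w b)"
  using assms
proof (induction c)
  case (Cons x c)
  have "inc_from (c @ w) x = inc_from w x" if "\<forall>y\<in>set c. y < x"
    using that by (induction c) auto
  moreover have "inc_from w x \<le> inc_from w b" if "b \<le> x" using that by (rule inc_from_antimono)
  ultimately show ?case using Cons by auto
qed simp

lemma inc_from_suffix: "inc_from w b \<le> inc_from (p @ w) b"
  by (induction p) (auto intro: le_trans)

text \<open>The topmost entries of the columns form a weakly increasing subsequence.\<close>

lemma length_le_inc_from:
  assumes "\<forall>c\<in>set cs. c \<noteq> []"
    and "\<forall>j. Suc j < length cs \<longrightarrow> columns_tableau (cs ! j) (cs ! Suc j)"
    and "cs \<noteq> [] \<Longrightarrow> b \<le> last (hd cs)"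
  shows "length cs \<le> inc_from (concat cs) b"
  using assms
proof (induction cs arbitrary: b)
  case (Cons c cs)
  have "c \<noteq> []" using Cons.prems by simp
  then have c: "c = butlast c @ [last c]" by simp
  have "cs \<noteq> [] \<Longrightarrow> last c \<le> last (hd cs)"
  proof -
    assume cs: "cs \<noteq> []"
    then have "columns_tableau c (hd cs)" "hd cs \<noteq> []"
      using Cons.prems(1) Cons.prems(2)[rule_format, of 0] by (auto simp: hd_conv_nth)
    then have "rev c ! 0 \<le> rev (hd cs) ! 0" by (auto simp: columns_tableau_def)
    then show ?thesis using \<open>c \<noteq> []\<close> \<open>hd cs \<noteq> []\<close>
      by (metis hd_conv_nth hd_rev rev_is_Nil_conv)
  qed
  then have "length cs \<le> inc_from (concat cs) (last c)"
    using Cons.prems by (intro Cons.IH) auto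
  then have "length (c # cs) \<le> inc_from ([last c] @ concat cs) b" using Cons.prems(3) by simp
  also have "\<dots> \<le> inc_from (butlast c @ [last c] @ concat cs) b" by (rule inc_from_suffix)
  also have "butlast c @ [last c] @ concat cs = concat (c # cs)" using c by simp
  finally show ?case .
qed simp

lemma tableau_word_pair:
  assumes "finite U" "finite V" "dominates U V"
  shows "tableau_word (pair_word U V)"
proof -
  \<comment> \<open>Empty columns leave no trace in the word and have to be left out of the list of its columns.\<close>
  have "columns_tableau (col U) (col V)" using assms by (simp add: columns_tableau_col)
  then show ?thesis unfolding tableau_word_def using assms
    by (intro exI[of _ "filter (\<lambda>c. c \<noteq> []) [col U, col V]"]) (auto simp: sorted_col less_Suc_eq)
qed

text \<open>A weakly increasing subsequence takes at most one letter from each of the two columns of a pair, while a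
  tableau with three columns has one of length three.\<close>

lemma tableau_word_two_columns:
  assumes "finite U" "finite V" "tableau_word t" "pair_word U V \<approx> t"
  shows "\<exists>X Y. finite X \<and> finite Y \<and> dominates X Y \<and> t = pair_word X Y"
proof -
  obtain cs where cs: "t = concat cs" "\<forall>c\<in>set cs. c \<noteq> [] \<and> sorted_wrt (>) c"
    "\<forall>j. Suc j < length cs \<longrightarrow> columns_tableau (cs ! j) (cs ! Suc j)"
    using assms(3) by (auto simp: tableau_word_def)
  have "length cs \<le> inc_from t 0"
    using cs by (simp add: length_le_inc_from)
  also have "\<dots> = inc_from (pair_word U V) 0"
    using knuth_eq_inc_from[OF assms(4)] by simp
  also have "\<dots> \<le> Suc (inc_from (col V @ []) 0)" using inc_from_column[OF sorted_col] by simp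
  also have "\<dots> \<le> 2" using inc_from_column[OF sorted_col, of V "[]" 0] by simp
  finally have "length cs \<le> 2" .
  then consider "cs = []" | c where "cs = [c]" | c d where "cs = [c, d]"
    by (cases cs; cases "tl cs") (auto simp: le_Suc_eq)
  then obtain c d where cd: "t = c @ d" "columns_tableau c d"
  proof cases
    case 1
    then show ?thesis using that[of "[]" "[]"] cs by (simp add: columns_tableau_def)
  next
    case (2 c)
    then show ?thesis using that[of c "[]"] cs by (simp add: columns_tableau_def)
  next
    case (3 c d)
    then show ?thesis using that[of c d] cs by simp
  qed
  then have "col (set c) = c" "col (set d) = d" by (auto simp: columns_tableau_def col_set)
  then show ?thesis using cd columns_tableau_col[of "set c" "set d"]
    by (intro exI[of _ "set c"] exI[of _ "set d"]) simp
qed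

lemma schensted_pair:
  assumes "finite U" "finite V" "finite X" "finite Y" "dominates X Y" "pair_word U V \<approx> pair_word X Y"
  shows "schensted (pair_word U V) = pair_word X Y"
  unfolding schensted_def
proof (rule the_equality)
  show "tableau_word (pair_word X Y) \<and> pair_word U V \<approx> pair_word X Y"
    using assms tableau_word_pair by blast
next
  fix t assume "tableau_word t \<and> pair_word U V \<approx> t"
  moreover from this obtain X' Y' where t: "finite X'" "finite Y'" "dominates X' Y'" "t = pair_word X' Y'"
    using tableau_word_two_columns[OF assms(1,2)] by blast
  ultimately have "pair_word X Y \<approx> pair_word X' Y'"
    using assms(6) by (blast intro: equivclp_trans equivclp_sym)
  then show "t = pair_word X Y" using tableau_unique_knuth[OF assms(3,4) t(1,2) assms(5) t(3)] t(4) by simp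
qed

lemma schensted_eq_iff:
  assumes "finite U" "finite V" "finite U'" "finite V'"
  shows "schensted (pair_word U V) = schensted (pair_word U' V') \<longleftrightarrow> pair_word U V \<approx> pair_word U' V'"
proof -
  obtain X Y where XY: "finite X" "finite Y" "dominates X Y" "pair_word U V \<approx> pair_word X Y"
    by (rule tableau_exists[OF assms(1,2)])
  obtain X' Y' where XY': "finite X'" "finite Y'" "dominates X' Y'" "pair_word U' V' \<approx> pair_word X' Y'"
    by (rule tableau_exists[OF assms(3,4)])
  show ?thesis
  proof
    assume "schensted (pair_word U V) = schensted (pair_word U' V')"
    then have "pair_word X Y = pair_word X' Y'"
      using schensted_pair[OF assms(1,2) XY] schensted_pair[OF assms(3,4) XY'] by simp
    then have "pair_word U' V' \<approx> pair_word X Y" using XY'(4) by simp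
    then show "pair_word U V \<approx> pair_word U' V'" using XY(4) by (blast intro: equivclp_trans equivclp_sym)
  next
    assume "pair_word U V \<approx> pair_word U' V'"
    then have "pair_word U V \<approx> pair_word X' Y'" using XY'(4) by (rule equivclp_trans)
    then show "schensted (pair_word U V) = schensted (pair_word U' V')"
      using schensted_pair[OF assms(1,2) XY'(1-3)] schensted_pair[OF assms(3,4) XY'] by simp
  qed
qed

section \<open>Flips\<close>

text \<open>The walk steps down at \<open>c\<close> and reaches its minimum there for the first time. Equivalently, \<open>c\<close>
  is the last unmatched closing bracket. The flip moves \<open>c\<close> from \<open>V\<close> to \<open>U\<close>.\<close>

definition flip :: "nat \<Rightarrow> nat set \<Rightarrow> nat set \<Rightarrow> bool" where
  "flip c U V \<longleftrightarrow> c \<in> V \<and> c \<notin> U \<and>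
     (\<forall>b\<le>c. height U V (Suc c) < height U V b) \<and> (\<forall>b>c. height U V (Suc c) \<le> height U V b)"

lemma height_flip:
  assumes "finite U" "finite V" "c \<in> V" "c \<notin> U"
  shows "height (insert c U) (V - {c}) b = height U V b + (if c < b then 2 else 0)"
  using below_insert[OF assms(1,4), of b] below_remove[OF assms(2,3), of b] by (simp add: height_def)

text \<open>Beyond \<open>c\<close> the flip raises the walk by two. The minimum of the new walk is then attained just before
  \<open>c\<close> and is one larger than the old one, which cancels the new letter of \<open>U\<close>.\<close>

lemma flip_dec_below:
  assumes fin: "finite U" "finite V" and "flip c U V"
  shows "dec_below (pair_word (insert c U) (V - {c})) = dec_below (pair_word U V)"
proof
  fix b
  let ?U = "insert c U" and ?V = "V - {c}"
  have c: "c \<in> V" "c \<notin> U" and lt: "\<And>b. b \<le> c \<Longrightarrow> height U V (Suc c) < height U V b"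
    and le: "\<And>b. c < b \<Longrightarrow> height U V (Suc c) \<le> height U V b"
    using assms(3) by (auto simp: flip_def)
  have fin': "finite ?U" "finite ?V" using fin by auto
  note h = height_flip[OF fin c] and bl = below_insert[OF fin(1) c(2), of b]
  have hc: "height U V c = height U V (Suc c) + 1" using c by (simp add: height_Suc)
  obtain m where m: "m \<le> b" "int (dec_below (pair_word U V) b) = int (below U b) - height U V m"
    using dec_below_pair_ex[OF fin] by blast
  obtain m' where m': "m' \<le> b" "int (dec_below (pair_word ?U ?V) b) = int (below ?U b) - height ?U ?V m'"
    using dec_below_pair_ex[OF fin'] by blast
  show "dec_below (pair_word ?U ?V) b = dec_below (pair_word U V) b"
  proof (cases "c < b")
    case False
    then show ?thesis
      using m m' dec_below_pair_ge[OF fin m'(1)] dec_below_pair_ge[OF fin' m(1)] h[of m] h[of m'] bl by simp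
  next
    case True
    have "height U V (Suc c) \<le> height U V m" using le[of m] lt[of m] by (cases "c < m") auto
    moreover have "height U V (Suc c) + 1 \<le> height ?U ?V m'"
      using le[of m'] lt[of m'] h[of m'] by (cases "c < m'") auto
    ultimately show ?thesis
      using m m' dec_below_pair_ge[OF fin, of "Suc c" b] dec_below_pair_ge[OF fin', of c b] h[of c] hc bl True
      by simp
  qed
qed

lemma flip_knuth_eq:
  assumes fin: "finite U" "finite V" and f: "flip c U V"
  shows "pair_word U V \<approx> pair_word (insert c U) (V - {c})"
proof (rule knuth_eq_pairI)
  show "dec_below (pair_word U V) = dec_below (pair_word (insert c U) (V - {c}))"
    using flip_dec_below[OF assms] by (rule sym)
  show "count_list (pair_word U V) = count_list (pair_word (insert c U) (V - {c}))"
    using assms by (auto simp: fun_eq_iff count_list_col flip_def)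
qed (use fin in auto)

text \<open>The walk becomes negative, and its first minimum is not at the start.\<close>

lemma flip_exists:
  assumes "finite U" "finite V" "\<not> dominates U V"
  shows "\<exists>c. flip c U V"
proof -
  let ?h = "height U V"
  have bound: "- int (card V) \<le> ?h b" for b
    using below_le_card[OF assms(2), of b] by (simp add: height_def)
  obtain b0 where b0: "\<And>b. nat (?h b0 + int (card V)) \<le> nat (?h b + int (card V))"
    using ex_has_least_nat[of "\<lambda>_. True" 0 "\<lambda>b. nat (?h b + int (card V))"] by auto
  have min: "?h b0 \<le> ?h b" for b using b0[of b] bound[of b] bound[of b0] by linarith
  define d where "d = (LEAST b. ?h b = ?h b0)"
  have d: "?h d = ?h b0" unfolding d_def by (rule LeastI) (rule refl)
  have first: "?h d < ?h b" if "b < d" for b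
    using not_less_Least[of b "\<lambda>b. ?h b = ?h b0"] that min[of b] d by (simp add: d_def[symmetric])
  obtain b1 where "?h b1 < 0" using assms(3) by (auto simp: dominates_height not_le)
  then have "?h d < 0" using min[of b1] d by simp
  then obtain c where c: "d = Suc c" by (cases d) auto
  have "?h (Suc c) < ?h c" using first[of c] c by simp
  then have "c \<in> V" "c \<notin> U" by (auto simp: height_Suc split: if_splits)
  then show ?thesis using first min d by (auto simp: flip_def c intro!: exI[of _ c])
qed

text \<open>A pair is a tableau or can be flipped, and a flip takes a letter away from \<open>V\<close>.\<close>

lemma flip_induct [consumes 2, case_names tableau flip]:
  assumes "finite U" "finite V"
    and tab: "\<And>U V. finite U \<Longrightarrow> finite V \<Longrightarrow> dominates U V \<Longrightarrow> P U V"
    and flip: "\<And>U V c. finite U \<Longrightarrow> finite V \<Longrightarrow> flip c U V \<Longrightarrow> P (insert c U) (V - {c}) \<Longrightarrow> P U V"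
  shows "P U V"
  using assms(1,2)
proof (induction "card V" arbitrary: U V)
  case 0
  then show ?case by (intro tab) (auto simp: dominates_def below_def)
next
  case (Suc k)
  show ?case
  proof (cases "dominates U V")
    case False
    then obtain c where c: "flip c U V" using flip_exists Suc by blast
    then have "k = card (V - {c})" using Suc by (simp add: flip_def)
    then show ?thesis using Suc c by (intro flip[OF _ _ c] Suc.hyps) auto
  qed (use Suc tab in auto)
qed

text \<open>A flip can be undone: \<open>c\<close> is the position where the walk of the flipped pair attains its minimum
  for the last time.\<close>

lemma flip_unique:
  assumes fin: "finite U" "finite V" "finite U'" "finite V'" and f: "flip c U V" "flip c' U' V'"
    and eq: "insert c U = insert c' U'" "V - {c} = V' - {c'}"
  shows "U = U' \<and> V = V'"
proof -
  have c: "c \<in> V" "c \<notin> U" "c' \<in> V'" "c' \<notin> U'" using f by (auto simp: flip_def)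
  have last: "height (insert c U) (V - {c}) c < height (insert c U) (V - {c}) b"
    if "c < b" "finite U" "finite V" "flip c U V" for b c U V
  proof -
    have "c \<in> V" "c \<notin> U" "height U V (Suc c) \<le> height U V b" using that by (auto simp: flip_def)
    then show ?thesis using height_flip[OF that(2,3), of c] that(1) by (simp add: height_Suc)
  qed
  have first: "height (insert c U) (V - {c}) c \<le> height (insert c U) (V - {c}) b"
    if "b < c" "finite U" "finite V" "flip c U V" for b c U V
  proof -
    have "c \<in> V" "c \<notin> U" "height U V (Suc c) < height U V b" using that by (auto simp: flip_def)
    then show ?thesis using height_flip[OF that(2,3), of c] that(1) by (simp add: height_Suc)
  qed
  have "c = c'"
  proof (rule linorder_cases[of c c'])
    assume "c < c'"
    then show ?thesis using last[OF _ fin(1,2) f(1)] first[OF _ fin(3,4) f(2)] unfolding eq by force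
  next
    assume "c' < c"
    then show ?thesis using last[OF _ fin(3,4) f(2)] first[OF _ fin(1,2) f(1)] unfolding eq by force
  qed
  with c have "U = insert c U - {c}" "U' = insert c' U' - {c'}" "V = insert c (V - {c})" "V' = insert c' (V' - {c'})"
    by (simp_all add: insert_absorb)
  then show ?thesis using eq \<open>c = c'\<close> by metis
qed

text \<open>For large bounds the invariant of a pair is the size of \<open>U\<close> minus the minimum of the walk, so the minimum
  is zero for one pair iff it is zero for the other one.\<close>

lemma dominates_if_same_card:
  assumes fin: "finite U" "finite V" "finite U'" "finite V'"
    and dom: "dominates U V" and eq: "pair_word U V \<approx> pair_word U' V'" and card: "card U = card U'"
  shows "dominates U' V'"
  unfolding dominates_height
proof
  fix m
  obtain N where N: "\<forall>x\<in>U \<union> U' \<union> {m}. x < N" using finite_nat_set_iff_bounded[of "U \<union> U' \<union> {m}"] fin by auto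
  then have "below U N = card U" "below U' N = card U'" by (auto intro!: below_large)
  then show "0 \<le> height U' V' m"
    using dec_below_pair_ge[OF fin(3,4), of m N] dec_below_dominates[OF fin(1,2) dom, of N]
      knuth_eq_dec_below[OF eq] card N by simp
qed

text \<open>Two equivalent pairs with left columns of equal size are flipped the same number of times until
  they become the same tableau, and flips are injective.\<close>

lemma knuth_eq_same_card:
  assumes "finite U" "finite V" "finite U'" "finite V'" "pair_word U V \<approx> pair_word U' V'" "card U = card U'"
  shows "U = U' \<and> V = V'"
  using assms
proof (induction arbitrary: U' V' rule: flip_induct)
  case (tableau U V)
  from dominates_if_same_card[OF tableau(1,2,4,5,3,6,7)]
  show ?case by (rule tableau_unique_knuth[OF tableau(1,2,4,5,3) _ tableau(6)])
next
  case (flip U V c)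
  have "\<not> dominates U' V'"
  proof
    assume "dominates U' V'"
    then have "dominates U V"
      using flip dominates_if_same_card[of U' V' U V] equivclp_sym[OF flip.prems(3)] by simp
    then have "0 \<le> height U V (Suc c)" by (simp add: dominates_height)
    moreover have "height U V (Suc c) < height U V 0" using flip.hyps(3) unfolding flip_def by blast
    ultimately show False by simp
  qed
  then obtain c' where c': "flip c' U' V'" using flip_exists[OF flip.prems(1,2)] by blast
  have c: "c \<notin> U" "c' \<notin> U'" using flip.hyps(3) c' by (auto simp: flip_def)
  have "pair_word (insert c U) (V - {c}) \<approx> pair_word U V"
    using flip_knuth_eq[OF flip.hyps] by (rule equivclp_sym)
  also have "pair_word U V \<approx> pair_word U' V'" by (rule flip.prems)
  also have "pair_word U' V' \<approx> pair_word (insert c' U') (V' - {c'})"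
    using flip.prems(1,2) c' by (rule flip_knuth_eq)
  finally have "insert c U = insert c' U' \<and> V - {c} = V' - {c'}"
    using flip.prems flip.hyps c by (intro flip.IH) auto
  then show ?case using flip_unique[OF flip.hyps(1,2) flip.prems(1,2) flip.hyps(3) c'] by blast
qed

text \<open>If the walk ends above its minimum, then the step after the last minimum is an opening bracket. Turning it into
  a closing one is an inverse flip.\<close>

lemma unflip_exists:
  assumes fin: "finite U" "finite V" and "height U V m < int (card U) - int (card V)"
  shows "\<exists>c\<in>U. c \<notin> V \<and> flip c (U - {c}) (insert c V)"
proof -
  let ?h = "height U V"
  obtain N where N: "\<forall>x\<in>U \<union> V \<union> {m}. x < N" using finite_nat_set_iff_bounded[of "U \<union> V \<union> {m}"] fin by auto
  then have top: "?h b = int (card U) - int (card V)" if "N \<le> b" for b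
    using that N by (intro height_large) (auto intro: less_le_trans[of _ N])
  \<comment> \<open>The walk is constant from \<open>N\<close> on and above its minimum there, so the last minimum is below \<open>N\<close>.\<close>
  define \<mu> where "\<mu> = Min (?h ` {..N})"
  have \<mu>: "\<mu> \<le> ?h b" if "b \<le> N" for b using that by (simp add: \<mu>_def)
  have "\<mu> \<le> ?h m" using \<mu>[of m] N by simp
  then have lt: "\<mu> < ?h b" if "N \<le> b" for b using top[OF that] assms(3) by simp
  have "\<mu> \<in> ?h ` {..N}" unfolding \<mu>_def by (rule Min_in) auto
  then have ne: "{b. b \<le> N \<and> ?h b = \<mu>} \<noteq> {}" by auto
  have finN: "finite {b. b \<le> N \<and> ?h b = \<mu>}" by simp
  define c where "c = Max {b. b \<le> N \<and> ?h b = \<mu>}"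
  have c: "c \<le> N" "?h c = \<mu>" using Max_in[OF finN ne] by (auto simp: c_def)
  have after: "\<mu> < ?h b" if "c < b" for b
  proof (cases "b \<le> N")
    case True
    have "?h b \<noteq> \<mu>" using Max_ge[OF finN, of b] True that by (auto simp: c_def[symmetric])
    then show ?thesis using \<mu>[OF True] by simp
  qed (use lt in simp)
  have before: "\<mu> \<le> ?h b" for b using \<mu>[of b] lt[of b] by (cases "b \<le> N") auto
  have cUV: "c \<in> U" "c \<notin> V" using after[of "Suc c"] c(2) by (auto simp: height_Suc split: if_splits)
  have h: "height (U - {c}) (insert c V) b = ?h b - (if c < b then 2 else 0)" for b
    using height_flip[of "U - {c}" "insert c V" c b] fin cUV by (simp add: insert_absorb)
  have "?h (Suc c) = \<mu> + 1" using cUV c(2) by (simp add: height_Suc)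
  then have "flip c (U - {c}) (insert c V)"
    unfolding flip_def h
  proof (intro conjI allI impI)
    fix b
    show "?h (Suc c) - (if c < Suc c then 2 else 0) < ?h b - (if c < b then 2 else 0)" if "b \<le> c"
      using that before[of b] \<open>?h (Suc c) = \<mu> + 1\<close> by simp
    show "?h (Suc c) - (if c < Suc c then 2 else 0) \<le> ?h b - (if c < b then 2 else 0)" if "c < b"
      using that after[of b] \<open>?h (Suc c) = \<mu> + 1\<close> by simp
  qed simp_all
  then show ?thesis using cUV by blast
qed

text \<open>Inverse flips, starting from a tableau, enlarge the right column one letter at a time. They are possible as long
  as the walk ends above its minimum; by the invariant, the minimum is the size of the left column minus the
  number of rows of the tableau.\<close>

lemma column_sizes_exist:
  assumes fin: "finite X" "finite Y" and dom: "dominates X Y" and "card Y \<le> q" "q \<le> card X"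
  shows "\<exists>U V. finite U \<and> finite V \<and> U \<union> V = X \<union> Y \<and> card V = q \<and>
     card U + q = card X + card Y \<and> pair_word U V \<approx> pair_word X Y"
  using assms(4,5)
proof (induction q rule: dec_induct)
  case base
  then show ?case using fin by (intro exI[of _ X] exI[of _ Y]) auto
next
  case (step q)
  then obtain U V where UV: "finite U" "finite V" "U \<union> V = X \<union> Y" "card V = q"
    "card U + q = card X + card Y" "pair_word U V \<approx> pair_word X Y" by auto
  \<comment> \<open>Above all letters, the counting functions give the sizes of the sets.\<close>
  obtain N where N: "\<forall>x\<in>U \<union> X. x < N" using finite_nat_set_iff_bounded[of "U \<union> X"] fin UV by auto
  then have N': "below U N = card U" "below X N = card X" by (auto intro!: below_large)
  obtain m where "int (dec_below (pair_word U V) N) = int (card U) - height U V m"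
    using dec_below_pair_ex[OF UV(1,2), of N] N' by auto
  then have "int (card X) = int (card U) - height U V m"
    using knuth_eq_dec_below[OF UV(6)] dec_below_dominates[OF fin dom, of N] N' by simp
  then have "height U V m < int (card U) - int (card V)" using UV step by simp
  then obtain c where c: "c \<in> U" "c \<notin> V" "flip c (U - {c}) (insert c V)"
    using unflip_exists UV by blast
  then have "pair_word (U - {c}) (insert c V) \<approx> pair_word U V"
    using flip_knuth_eq[of "U - {c}" "insert c V" c] UV by (simp add: insert_absorb)
  then have "pair_word (U - {c}) (insert c V) \<approx> pair_word X Y" using UV(6) by (rule equivclp_trans)
  moreover have "card (U - {c}) + Suc q = card X + card Y"
    using c UV card_Suc_Diff1[of U c] by simp
  ultimately show ?case using c UV by (intro exI[of _ "U - {c}"] exI[of _ "insert c V"]) auto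
qed

section \<open>Duality\<close>

text \<open>The letter set of \<open>c\<^sup>\<or>\<^sup>*\<close>, in the alphabet \<open>{1..N}\<close>.\<close>

definition dual :: "nat \<Rightarrow> nat set \<Rightarrow> nat set" where
  "dual N U = {x \<in> {1..N}. N + 1 - x \<notin> U}"

lemma dual_subset: "dual N U \<subseteq> {1..N}"
  by (auto simp: dual_def)

lemma finite_dual [simp]: "finite (dual N U)"
  by (simp add: dual_def)

lemma dual_star_col:
  assumes "finite U"
  shows "dual_star n (col U) = col (dual (2 * n) U)"
proof -
  have "{2 * n + 1 - i | i. i \<in> {1..2 * n} \<and> i \<notin> U} = dual (2 * n) U"
  proof (intro equalityI subsetI)
    fix x assume "x \<in> dual (2 * n) U"
    then have "x = 2 * n + 1 - (2 * n + 1 - x) \<and> 2 * n + 1 - x \<in> {1..2 * n} \<and> 2 * n + 1 - x \<notin> U"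
      by (auto simp: dual_def)
    then show "x \<in> {2 * n + 1 - i | i. i \<in> {1..2 * n} \<and> i \<notin> U}" by blast
  qed (auto simp: dual_def)
  then show ?thesis using assms by (simp add: dual_star_def col_def)
qed

lemma below_dual:
  assumes "U \<subseteq> {1..N}" "1 \<le> b" "b \<le> N + 1"
  shows "below (dual N U) b + card U = (b - 1) + below U (N + 2 - b)"
  using assms(2,3)
proof (induction b rule: dec_induct)
  case base
  have "below U (N + 1) = card U" using assms(1) by (intro below_large) auto
  moreover have "below (dual N U) 1 = 0" by (auto simp: below_def dual_def)
  ultimately show ?case by simp
next
  case (step b)
  have "N + 2 - b = Suc (N + 1 - b)" using step by simp
  moreover have "N + 2 - Suc b = N + 1 - b" by simp
  moreover have "b \<in> dual N U \<longleftrightarrow> N + 1 - b \<notin> U" using step by (auto simp: dual_def)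
  ultimately show ?case using step by (auto simp: below_Suc split: if_splits)
qed

lemma card_dual:
  assumes "U \<subseteq> {1..N}"
  shows "card (dual N U) + card U = N"
proof -
  have "below (dual N U) (N + 1) = card (dual N U)"
    using dual_subset by (intro below_large) force
  moreover have "below U 1 = 0" using assms by (auto simp: below_def)
  ultimately show ?thesis using below_dual[OF assms, of "N + 1"] by simp
qed

text \<open>The dual bracket word is the reversed one with opening and closing brackets exchanged, so its walk is the
  old walk run backwards, shifted to start at zero.\<close>

lemma height_dual:
  assumes "U \<subseteq> {1..N}" "V \<subseteq> {1..N}" "1 \<le> b" "b \<le> N + 1"
  shows "height (dual N U) (dual N V) b = height U V (N + 2 - b) - (int (card U) - int (card V))"
  using below_dual[OF assms(1,3,4)] below_dual[OF assms(2,3,4)] by (simp add: height_def)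

text \<open>The walk is constant outside the alphabet, so statements about all positions reduce to the positions
  to which the formula for the dual walk applies.\<close>

lemma height_clamp:
  assumes "U \<subseteq> {1..N}" "V \<subseteq> {1..N}"
  shows "height U V b = height U V (max 1 (min b (N + 1)))"
proof -
  consider "b = 0" | "1 \<le> b" "b \<le> N + 1" | "N + 1 < b" by linarith
  then show ?thesis
  proof cases
    case 1
    have "below U 1 = 0" "below V 1 = 0" using assms by (auto simp: below_def)
    then show ?thesis using 1 by (simp add: height_def)
  next
    case 3
    then have "U \<union> V \<subseteq> {..<b}" "U \<union> V \<subseteq> {..<N + 1}" using assms by force+
    then show ?thesis using 3 height_large[of U V b] height_large[of U V "N + 1"] by (simp add: max_def)
  qed simp
qed

text \<open>The first minimum of a walk is the last minimum of the reversed walk. The flipped pair attains its minimum for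
  the last time just before \<open>c\<close>, and so its dual attains the minimum for the first time at the mirror image of \<open>c\<close>.\<close>

lemma flip_dual:
  assumes sub: "U \<subseteq> {1..N}" "V \<subseteq> {1..N}" and f: "flip c U V"
  shows "flip (N + 1 - c) (dual N (insert c U)) (dual N (V - {c}))"
proof -
  let ?U = "insert c U" and ?V = "V - {c}"
  let ?H = "height (dual N ?U) (dual N ?V)"
  have c: "c \<in> V" "c \<notin> U" and lt: "\<And>b. b \<le> c \<Longrightarrow> height U V (Suc c) < height U V b"
    and le: "\<And>b. c < b \<Longrightarrow> height U V (Suc c) \<le> height U V b"
    using f by (auto simp: flip_def)
  have cN: "1 \<le> c" "c \<le> N" using c sub by auto
  have sub': "?U \<subseteq> {1..N}" "?V \<subseteq> {1..N}" using sub cN by auto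
  have fin: "finite U" "finite V" using sub finite_subset by blast+
  let ?d = "int (card ?U) - int (card ?V)"
  have h: "?H b = height U V (N + 2 - b) + (if c < N + 2 - b then 2 else 0) - ?d"
    if "1 \<le> b" "b \<le> N + 1" for b
    using height_dual[OF sub' that] height_flip[OF fin c] by simp
  have hc: "height U V c = height U V (Suc c) + 1" using c by (simp add: height_Suc)
  \<comment> \<open>The mirror image of this position is \<open>c\<close>, just before the walk first reaches its minimum.\<close>
  have H: "?H (Suc (N + 1 - c)) = height U V c - ?d"
    using h[of "Suc (N + 1 - c)"] cN by simp
  have clamp: "?H b = ?H (max 1 (min b (N + 1)))" for b
    by (rule height_clamp[OF dual_subset dual_subset])
  have A: "?H (Suc (N + 1 - c)) < ?H b" if "b \<le> N + 1 - c" for b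
  proof -
    define b' where "b' = max 1 (min b (N + 1))"
    have b': "1 \<le> b'" "b' \<le> N + 1 - c" "b' \<le> N + 1" using that cN by (auto simp: b'_def)
    then have "c < N + 2 - b'" using cN by simp
    moreover from this have "height U V (Suc c) \<le> height U V (N + 2 - b')" by (rule le)
    ultimately have "?H (Suc (N + 1 - c)) < ?H b'" using H h[OF b'(1,3)] hc by simp
    then show ?thesis using clamp[of b] by (simp add: b'_def)
  qed
  have B: "?H (Suc (N + 1 - c)) \<le> ?H b" if "N + 1 - c < b" for b
  proof -
    define b' where "b' = max 1 (min b (N + 1))"
    have b': "1 \<le> b'" "N + 1 - c < b'" "b' \<le> N + 1" using that cN by (auto simp: b'_def)
    then have "N + 2 - b' \<le> c" using cN by simp
    moreover from this have "height U V (Suc c) < height U V (N + 2 - b')" by (rule lt)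
    ultimately have "?H (Suc (N + 1 - c)) \<le> ?H b'" using H h[OF b'(1,3)] hc by simp
    then show ?thesis using clamp[of b] by (simp add: b'_def)
  qed
  have "N + 1 - c \<in> dual N ?V" "N + 1 - c \<notin> dual N ?U" using cN by (auto simp: dual_def)
  then show ?thesis unfolding flip_def using A B by blast
qed

lemma dual_flip_eq:
  assumes "1 \<le> c" "c \<le> N"
  shows "c \<notin> U \<Longrightarrow> insert (N + 1 - c) (dual N (insert c U)) = dual N U"
    and "c \<in> V \<Longrightarrow> dual N (V - {c}) - {N + 1 - c} = dual N V"
  using assms by (auto simp: dual_def)

lemma flip_dual_knuth_eq:
  assumes sub: "U \<subseteq> {1..N}" "V \<subseteq> {1..N}" and f: "flip c U V"
  shows "pair_word (dual N U) (dual N V) \<approx> pair_word (dual N (insert c U)) (dual N (V - {c}))"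
proof -
  have c: "c \<in> V" "c \<notin> U" "1 \<le> c" "c \<le> N" using sub f by (auto simp: flip_def)
  show ?thesis
    using flip_knuth_eq[OF _ _ flip_dual[OF assms]] dual_flip_eq(1)[OF c(3,4,2)] dual_flip_eq(2)[OF c(3,4,1)]
    by (simp add: equivclp_sym)
qed

definition self_dual :: "nat \<Rightarrow> nat set \<Rightarrow> nat set \<Rightarrow> bool" where
  "self_dual N U V \<longleftrightarrow> pair_word (dual N U) (dual N V) \<approx> pair_word U V"

lemma self_dual_transfer:
  assumes "pair_word U V \<approx> pair_word X Y" "pair_word (dual N U) (dual N V) \<approx> pair_word (dual N X) (dual N Y)"
  shows "self_dual N U V \<longleftrightarrow> self_dual N X Y"
  unfolding self_dual_def using assms by (blast intro: equivclp_trans equivclp_sym)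

text \<open>If the walk reached its minimum only above \<open>n\<close>, then the reversed walk would reach it among the letters
  at most \<open>n\<close>. The invariant of the dual word at \<open>n + 1\<close> would then be larger than that of the word itself.\<close>

lemma self_dual_flip_le:
  assumes sub: "U \<subseteq> {1..2 * n}" "V \<subseteq> {1..2 * n}" and card: "card U + card V = 2 * n" "card V \<le> card U"
    and sd: "self_dual (2 * n) U V" and f: "flip c U V"
  shows "c \<le> n"
proof (rule ccontr)
  assume "\<not> c \<le> n"
  have cV: "c \<in> V" and lt: "\<And>b. b \<le> c \<Longrightarrow> height U V (Suc c) < height U V b" using f by (auto simp: flip_def)
  have c: "n < c" "c \<le> 2 * n" using \<open>\<not> c \<le> n\<close> cV sub by auto
  have fin: "finite U" "finite V" using sub finite_subset by blast+
  let ?D = "int (dec_below (pair_word U V) (n + 1))"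
  obtain m where m: "m \<le> n + 1" "?D = int (below U (n + 1)) - height U V m"
    using dec_below_pair_ex[OF fin] by blast
  \<comment> \<open>The position \<open>2n + 1 - c\<close> is the mirror image of \<open>c + 1\<close>, where the walk is minimal.\<close>
  have "int (below (dual (2 * n) U) (n + 1)) - height (dual (2 * n) U) (dual (2 * n) V) (2 * n + 1 - c) \<le> ?D"
    using dec_below_pair_ge[of "dual (2 * n) U" "dual (2 * n) V" "2 * n + 1 - c" "n + 1"] c
      knuth_eq_dec_below[OF sd[unfolded self_dual_def]] by simp
  moreover have "height (dual (2 * n) U) (dual (2 * n) V) (2 * n + 1 - c) =
      height U V (Suc c) - (int (card U) - int (card V))"
    using height_dual[OF sub, of "2 * n + 1 - c"] c by simp
  moreover have "below (dual (2 * n) U) (n + 1) + card U = n + below U (n + 1)"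
    using below_dual[OF sub(1), of "n + 1"] by simp
  ultimately have "height U V m \<le> height U V (Suc c)" using m card by linarith
  then show False using lt[of m] m c by simp
qed

text \<open>If the walk is minimal on the upper half at \<open>n + 1\<close>, this value bounds the reversed walk from below on the
  lower half, and hence the invariant of the dual word from above. The invariant of the word is at least the
  number of letters of \<open>U\<close> up to \<open>n\<close>.\<close>

lemma self_dual_upper_excess:
  assumes sub: "U \<subseteq> {1..2 * n}" "V \<subseteq> {1..2 * n}" and sd: "self_dual (2 * n) U V"
    and dom: "\<And>b. n + 1 \<le> b \<Longrightarrow> height U V (n + 1) \<le> height U V b"
  shows "height U V (n + 1) \<le> int n - int (card V)"
proof -
  have fin: "finite U" "finite V" using sub finite_subset by blast+
  let ?D = "int (dec_below (pair_word U V) (n + 1))"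
  obtain m where m: "m \<le> n + 1" "?D = int (below (dual (2 * n) U) (n + 1)) - height (dual (2 * n) U) (dual (2 * n) V) m"
    using dec_below_pair_ex[of "dual (2 * n) U" "dual (2 * n) V" "n + 1"]
      knuth_eq_dec_below[OF sd[unfolded self_dual_def]] by auto
  define m' where "m' = max 1 (min m (2 * n + 1))"
  have m': "1 \<le> m'" "m' \<le> n + 1" using m(1) by (auto simp: m'_def)
  have "height (dual (2 * n) U) (dual (2 * n) V) m = height U V (2 * n + 2 - m') - (int (card U) - int (card V))"
    using height_clamp[OF dual_subset dual_subset, of "2 * n" U V m] height_dual[OF sub, of m'] m'
    by (simp add: m'_def)
  moreover have "height U V (n + 1) \<le> height U V (2 * n + 2 - m')" using m' by (intro dom) simp
  moreover have "int (below U (n + 1)) \<le> ?D" using dec_below_pair_ge[OF fin, of 0 "n + 1"] by simp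
  moreover have "below (dual (2 * n) U) (n + 1) + card U = n + below U (n + 1)"
    using below_dual[OF sub(1), of "n + 1"] by simp
  ultimately show ?thesis using m(2) by linarith
qed

text \<open>Flips transform the pair into its tableau. They preserve self-duality, and along a self-dual pair they only
  move letters that are at most \<open>n\<close>.\<close>

lemma tableau_reduction:
  assumes "U \<subseteq> {1..2 * n}" "V \<subseteq> {1..2 * n}" "card U + card V = 2 * n" "card V \<le> card U"
  shows "\<exists>X Y. X \<subseteq> {1..2 * n} \<and> Y \<subseteq> {1..2 * n} \<and> card X + card Y = 2 * n \<and> card Y \<le> card V \<and>
     dominates X Y \<and> pair_word U V \<approx> pair_word X Y \<and>
     (self_dual (2 * n) U V \<longleftrightarrow> self_dual (2 * n) X Y) \<and>
     (self_dual (2 * n) U V \<longrightarrow> X \<inter> {n<..} = U \<inter> {n<..} \<and> Y \<inter> {n<..} = V \<inter> {n<..})"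
proof -
  have "finite U" "finite V" using assms finite_subset by blast+
  then show ?thesis using assms
  proof (induction rule: flip_induct)
    case (tableau U V)
    then show ?case by (intro exI[of _ U] exI[of _ V]) auto
  next
    case (flip U V c)
    have c: "c \<in> V" "c \<notin> U" using flip.hyps(3) by (auto simp: flip_def)
    have "Suc (card (V - {c})) = card V" "card (insert c U) = Suc (card U)"
      using card_Suc_Diff1[OF flip.hyps(2) c(1)] card_insert_disjoint[OF flip.hyps(1) c(2)] by simp_all
    then have cards: "card (insert c U) + card (V - {c}) = 2 * n" "card (V - {c}) \<le> card V"
      "card (V - {c}) \<le> card (insert c U)"
      using flip.prems(3,4) by linarith+
    have sub: "insert c U \<subseteq> {1..2 * n}" "V - {c} \<subseteq> {1..2 * n}" using flip.prems c by auto
    obtain X Y where XY: "X \<subseteq> {1..2 * n}" "Y \<subseteq> {1..2 * n}" "card X + card Y = 2 * n"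
      "card Y \<le> card (V - {c})" "dominates X Y" "pair_word (insert c U) (V - {c}) \<approx> pair_word X Y"
      "self_dual (2 * n) (insert c U) (V - {c}) \<longleftrightarrow> self_dual (2 * n) X Y"
      "self_dual (2 * n) (insert c U) (V - {c}) \<longrightarrow>
        X \<inter> {n<..} = insert c U \<inter> {n<..} \<and> Y \<inter> {n<..} = (V - {c}) \<inter> {n<..}"
      using flip.IH[OF sub cards(1,3)] by blast
    have eq: "pair_word U V \<approx> pair_word (insert c U) (V - {c})"
      by (rule flip_knuth_eq[OF flip.hyps])
    have sd: "self_dual (2 * n) U V \<longleftrightarrow> self_dual (2 * n) (insert c U) (V - {c})"
      by (rule self_dual_transfer[OF eq flip_dual_knuth_eq[OF flip.prems(1,2) flip.hyps(3)]])
    have "X \<inter> {n<..} = U \<inter> {n<..} \<and> Y \<inter> {n<..} = V \<inter> {n<..}" if "self_dual (2 * n) U V"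
    proof -
      have "c \<le> n" by (rule self_dual_flip_le[OF flip.prems that flip.hyps(3)])
      then have "insert c U \<inter> {n<..} = U \<inter> {n<..}" "(V - {c}) \<inter> {n<..} = V \<inter> {n<..}" by auto
      then show ?thesis using XY(8) that sd by simp
    qed
    moreover have "pair_word U V \<approx> pair_word X Y" using eq XY(6) by (rule equivclp_trans)
    moreover have "card Y \<le> card V" using XY(4) cards(2) by (rule le_trans)
    ultimately show ?case using XY(1-3,5,7) sd by blast
  qed
qed

lemma dual_mem: 
  assumes "1 \<le> i" "i < N"
  shows "N - i \<in> dual N U \<longleftrightarrow> Suc i \<notin> U" "Suc (N - i) \<in> dual N U \<longleftrightarrow> i \<notin> U"
  using assms by (auto simp: dual_def Suc_diff_le)

lemma dual_shift:
  assumes "1 \<le> i" "i < N" 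
  shows "insert (Suc (N - i)) (dual N U - {N - i}) = dual N (insert (Suc i) (U - {i}))"
    and "insert (N - i) (dual N U - {Suc (N - i)}) = dual N (insert i (U - {Suc i}))"
  using assms by (auto simp: dual_def)

text \<open>Duality interchanges the presence of \<open>i\<close> in a column with the absence of \<open>N + 1 - i\<close>, so a free \<open>i\<close> in a column
  becomes a free \<open>N - i\<close> in its dual, and the two columns stay in their places.\<close>

lemma f_pair_dual:
  assumes "1 \<le> i" "i < N"
  shows "f_pair (N - i) (dual N U, dual N V) = map_option (\<lambda>(U, V). (dual N U, dual N V)) (f_pair i (U, V))"
  using assms by (simp add: f_pair_def dual_mem dual_shift)

lemma e_pair_dual:
  assumes "1 \<le> i" "i < N"
  shows "e_pair (N - i) (dual N U, dual N V) = map_option (\<lambda>(U, V). (dual N U, dual N V)) (e_pair i (U, V))"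
  using assms by (simp add: e_pair_def dual_mem dual_shift)

section \<open>Admissible tableaux are preserved by the virtual operators\<close>

lemma f_pair_eq_Some_iff:
  "f_pair i (U, V) = Some (U', V') \<longleftrightarrow>
     i \<in> V \<and> Suc i \<notin> V \<and> (Suc i \<in> U \<longrightarrow> i \<in> U) \<and> U' = U \<and> V' = insert (Suc i) (V - {i}) \<or>
     i \<in> U \<and> Suc i \<notin> U \<and> (i \<in> V \<longrightarrow> Suc i \<in> V) \<and> U' = insert (Suc i) (U - {i}) \<and> V' = V"
  by (auto simp: f_pair_def)

lemma e_pair_eq_Some_iff:
  "e_pair i (U, V) = Some (U', V') \<longleftrightarrow>
     Suc i \<in> U \<and> i \<notin> U \<and> (i \<in> V \<longrightarrow> Suc i \<in> V) \<and> U' = insert i (U - {Suc i}) \<and> V' = V \<or>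
     Suc i \<in> V \<and> i \<notin> V \<and> (Suc i \<in> U \<longrightarrow> i \<in> U) \<and> U' = U \<and> V' = insert i (V - {Suc i})"
  by (auto simp: e_pair_def)

lemma below_shift_up:
  assumes "finite U" "i \<in> U" "Suc i \<notin> U"
  shows "below U b = below (insert (Suc i) (U - {i})) b + (if b = Suc i then 1 else 0)"
  using below_remove[OF assms(1,2), of b] below_insert[of "U - {i}" "Suc i" b] assms by auto

lemma below_shift_down:
  assumes "finite U" "Suc i \<in> U" "i \<notin> U"
  shows "below (insert i (U - {Suc i})) b = below U b + (if b = Suc i then 1 else 0)"
  using below_remove[OF assms(1,2), of b] below_insert[of "U - {Suc i}" "i" b] assms by auto

text \<open>Only the counts of letters below \<open>i + 1\<close> change. Lowering this count for \<open>U\<close> is harmless: if \<open>i\<close> is not in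
  \<open>V\<close>, compare the counts below \<open>i\<close>, and otherwise those below \<open>i + 2\<close>.\<close>

lemma f_pair_dominates:
  assumes fin: "finite U" "finite V" and dom: "dominates U V" and f: "f_pair i (U, V) = Some (U', V')"
  shows "dominates U' V'"
  unfolding dominates_def
proof
  fix b
  have d: "below V i \<le> below U i" "below V (Suc i) \<le> below U (Suc i)"
    "below V (Suc (Suc i)) \<le> below U (Suc (Suc i))" "below V b \<le> below U b"
    using dom by (simp_all add: dominates_def)
  from f consider
    "i \<in> V" "Suc i \<notin> V" "U' = U" "V' = insert (Suc i) (V - {i})"
    | "i \<in> U" "Suc i \<notin> U" "i \<in> V \<longrightarrow> Suc i \<in> V" "U' = insert (Suc i) (U - {i})" "V' = V"
    unfolding f_pair_eq_Some_iff by blast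
  then show "below V' b \<le> below U' b"
  proof cases
    case 1
    then show ?thesis using below_shift_up[OF fin(2) 1(1,2), of b] d by simp
  next
    case 2
    then show ?thesis
      using below_shift_up[OF fin(1) 2(1,2), of b] d by (auto simp: below_Suc split: if_splits)
  qed
qed

lemma e_pair_dominates:
  assumes fin: "finite U" "finite V" and dom: "dominates U V" and e: "e_pair i (U, V) = Some (U', V')"
  shows "dominates U' V'"
  unfolding dominates_def
proof
  fix b
  have d: "below V i \<le> below U i" "below V (Suc i) \<le> below U (Suc i)"
    "below V (Suc (Suc i)) \<le> below U (Suc (Suc i))" "below V b \<le> below U b"
    using dom by (simp_all add: dominates_def)
  from e consider
    "Suc i \<in> U" "i \<notin> U" "U' = insert i (U - {Suc i})" "V' = V"
    | "Suc i \<in> V" "i \<notin> V" "Suc i \<in> U \<longrightarrow> i \<in> U" "U' = U" "V' = insert i (V - {Suc i})"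
    unfolding e_pair_eq_Some_iff by blast
  then show "below V' b \<le> below U' b"
  proof cases
    case 1
    then show ?thesis using below_shift_down[OF fin(1) 1(1,2), of b] d by simp
  next
    case 2
    then show ?thesis
      using below_shift_down[OF fin(2) 2(1,2), of b] d by (auto simp: below_Suc split: if_splits)
  qed
qed

text \<open>An operator of index different from \<open>m\<close> does not mix the letters up to \<open>m\<close> with those above \<open>m\<close>.\<close>

lemma f_pair_above:
  assumes "f_pair i (U, V) = Some (U', V')" "i \<noteq> m"
  shows "U' \<inter> {m<..} = U \<inter> {m<..} \<and> V' \<inter> {m<..} = V \<inter> {m<..} \<or>
    f_pair i (U \<inter> {m<..}, V \<inter> {m<..}) = Some (U' \<inter> {m<..}, V' \<inter> {m<..})"
proof (cases "i < m")
  case True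
  then show ?thesis using assms(1) unfolding f_pair_eq_Some_iff by auto
next
  case False
  then show ?thesis using assms unfolding f_pair_eq_Some_iff by auto
qed

lemma e_pair_above:
  assumes "e_pair i (U, V) = Some (U', V')" "i \<noteq> m"
  shows "U' \<inter> {m<..} = U \<inter> {m<..} \<and> V' \<inter> {m<..} = V \<inter> {m<..} \<or>
    e_pair i (U \<inter> {m<..}, V \<inter> {m<..}) = Some (U' \<inter> {m<..}, V' \<inter> {m<..})"
proof (cases "i < m")
  case True
  then show ?thesis using assms(1) unfolding e_pair_eq_Some_iff by auto
next
  case False
  then show ?thesis using assms unfolding e_pair_eq_Some_iff by auto
qed

lemma f_pair_dominates_above:
  assumes "finite U" "finite V" "dominates (U \<inter> {m<..}) (V \<inter> {m<..})" "f_pair i (U, V) = Some (U', V')" "i \<noteq> m"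
  shows "dominates (U' \<inter> {m<..}) (V' \<inter> {m<..})"
  using f_pair_above[OF assms(4,5)] f_pair_dominates[OF _ _ assms(3)] assms(1-3) by auto

lemma e_pair_dominates_above:
  assumes "finite U" "finite V" "dominates (U \<inter> {m<..}) (V \<inter> {m<..})" "e_pair i (U, V) = Some (U', V')" "i \<noteq> m"
  shows "dominates (U' \<inter> {m<..}) (V' \<inter> {m<..})"
  using e_pair_above[OF assms(4,5)] e_pair_dominates[OF _ _ assms(3)] assms(1-3) by auto

lemma shift_shape:
  assumes "finite U" "U \<subseteq> {1..N}" "1 \<le> i" "i < N"
  shows "i \<in> U \<Longrightarrow> Suc i \<notin> U \<Longrightarrow>
      insert (Suc i) (U - {i}) \<subseteq> {1..N} \<and> card (insert (Suc i) (U - {i})) = card U"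
    and "Suc i \<in> U \<Longrightarrow> i \<notin> U \<Longrightarrow>
      insert i (U - {Suc i}) \<subseteq> {1..N} \<and> card (insert i (U - {Suc i})) = card U"
proof -
  assume "i \<in> U" "Suc i \<notin> U"
  then show "insert (Suc i) (U - {i}) \<subseteq> {1..N} \<and> card (insert (Suc i) (U - {i})) = card U"
    using assms card_Suc_Diff1[of U i] by auto
next
  assume "Suc i \<in> U" "i \<notin> U"
  then show "insert i (U - {Suc i}) \<subseteq> {1..N} \<and> card (insert i (U - {Suc i})) = card U"
    using assms card_Suc_Diff1[of U "Suc i"] by auto
qed

lemma f_pair_shape:
  assumes "U \<subseteq> {1..N}" "V \<subseteq> {1..N}" "1 \<le> i" "i < N" "f_pair i (U, V) = Some (U', V')"
  shows "U' \<subseteq> {1..N} \<and> V' \<subseteq> {1..N} \<and> card U' = card U \<and> card V' = card V"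
  using assms shift_shape(1)[of U N i] shift_shape(1)[of V N i] finite_subset[OF assms(1)] finite_subset[OF assms(2)]
  unfolding f_pair_eq_Some_iff by auto

lemma e_pair_shape:
  assumes "U \<subseteq> {1..N}" "V \<subseteq> {1..N}" "1 \<le> i" "i < N" "e_pair i (U, V) = Some (U', V')"
  shows "U' \<subseteq> {1..N} \<and> V' \<subseteq> {1..N} \<and> card U' = card U \<and> card V' = card V"
  using assms shift_shape(2)[of U N i] shift_shape(2)[of V N i] finite_subset[OF assms(1)] finite_subset[OF assms(2)]
  unfolding e_pair_eq_Some_iff by auto

text \<open>The two columns, of heights \<open>2n - k\<close> and \<open>k\<close>, of a tableau that satisfies the first two conditions of the
  theorem.\<close>

definition admissible :: "nat \<Rightarrow> nat \<Rightarrow> nat set \<Rightarrow> nat set \<Rightarrow> bool" where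
  "admissible n k X Y \<longleftrightarrow> X \<subseteq> {1..2 * n} \<and> Y \<subseteq> {1..2 * n} \<and> card X = 2 * n - k \<and> card Y = k \<and>
     dominates X Y \<and> self_dual (2 * n) X Y \<and> dominates (X \<inter> {n<..}) (Y \<inter> {n<..})"

lemma f_pair_finite:
  assumes "f_pair i (U, V) = Some (U', V')" "finite U" "finite V"
  shows "finite U' \<and> finite V'"
  using assms unfolding f_pair_eq_Some_iff by auto

lemma e_pair_finite:
  assumes "e_pair i (U, V) = Some (U', V')" "finite U" "finite V"
  shows "finite U' \<and> finite V'"
  using assms unfolding e_pair_eq_Some_iff by auto

text \<open>Write \<open>w\<close> for the word of \<open>(U, V)\<close> and \<open>d\<close> for the dual word. The two operators act on \<open>w\<close> in one
  order and, by duality, on \<open>d\<close> in the opposite order. As \<open>w\<close> and \<open>d\<close> are Knuth equivalent, the results are equivalent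
  once the operators are commuted on \<open>w\<close>. Raising and lowering operators are both instances.\<close>

lemma self_dual_step:
  fixes act :: "nat \<Rightarrow> nat list \<Rightarrow> nat list option"
    and pair_act :: "nat \<Rightarrow> nat set \<times> nat set \<Rightarrow> (nat set \<times> nat set) option"
  assumes knuth: "\<And>w w' i v. w \<approx> w' \<Longrightarrow> act i w = Some v \<Longrightarrow> \<exists>v'. act i w' = Some v' \<and> v \<approx> v'"
    and comm: "\<And>i j w w1 w2. Suc i < j \<or> Suc j < i \<Longrightarrow> act i w = Some w1 \<Longrightarrow> act j w = Some w2 \<Longrightarrow>
       \<exists>w'. act j w1 = Some w' \<and> act i w2 = Some w'"
    and word: "\<And>U V i. finite U \<Longrightarrow> finite V \<Longrightarrow>
       act i (pair_word U V) = map_option (\<lambda>(U, V). pair_word U V) (pair_act i (U, V))"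
    and dual: "\<And>i N U V. 1 \<le> i \<Longrightarrow> i < N \<Longrightarrow> pair_act (N - i) (dual N U, dual N V) =
       map_option (\<lambda>(U, V). (dual N U, dual N V)) (pair_act i (U, V))"
    and fin: "finite U" "finite V" "finite U1" "finite V1" and i: "1 \<le> i" "i \<le> n"
    and steps: "pair_act i (U, V) = Some (U1, V1)" "pair_act (2 * n - i) (U1, V1) = Some (U2, V2)"
    and sd: "self_dual (2 * n) U V"
  shows "self_dual (2 * n) U2 V2"
proof -
  let ?d = "\<lambda>U V. pair_word (dual (2 * n) U) (dual (2 * n) V)"
  have w: "act i (pair_word U V) = Some (pair_word U1 V1)"
    "act (2 * n - i) (pair_word U1 V1) = Some (pair_word U2 V2)"
    using steps fin by (simp_all add: word)
  have "pair_act (2 * n - i) (dual (2 * n) U, dual (2 * n) V) = Some (dual (2 * n) U1, dual (2 * n) V1)"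
    using dual[of i "2 * n" U V] i steps(1) by simp
  then have d1: "act (2 * n - i) (?d U V) = Some (?d U1 V1)" by (simp add: word)
  have "2 * n - (2 * n - i) = i" using i by simp
  then have "pair_act i (dual (2 * n) U1, dual (2 * n) V1) = Some (dual (2 * n) U2, dual (2 * n) V2)"
    using dual[of "2 * n - i" "2 * n" U1 V1] i steps(2) by simp
  then have d2: "act i (?d U1 V1) = Some (?d U2 V2)" by (simp add: word)
  obtain s where s: "act (2 * n - i) (pair_word U V) = Some s" "?d U1 V1 \<approx> s"
    using knuth[OF sd[unfolded self_dual_def] d1] by blast
  obtain s' where s': "act i s = Some s'" "?d U2 V2 \<approx> s'" using knuth[OF s(2) d2] by blast
  have "s' = pair_word U2 V2"
  proof (cases "i = n")
    case True
    then show ?thesis using w s s' by simp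
  next
    case False
    then have "Suc i < 2 * n - i" using i by linarith
    then have "Suc i < 2 * n - i \<or> Suc (2 * n - i) < i" ..
    from comm[OF this w(1) s(1)] show ?thesis using w(2) s'(1) by auto
  qed
  then show ?thesis using s'(2) by (simp add: self_dual_def)
qed

lemma self_dual_f:
  assumes "finite U" "finite V" "finite U1" "finite V1" "1 \<le> i" "i \<le> n"
    "f_pair i (U, V) = Some (U1, V1)" "f_pair (2 * n - i) (U1, V1) = Some (U2, V2)"
    "self_dual (2 * n) U V"
  shows "self_dual (2 * n) U2 V2"
  by (rule self_dual_step[where act = f_word and pair_act = f_pair, OF _ _ _ _ assms])
    (fact knuth_eq_f_word f_word_commute f_word_pair f_pair_dual)+

lemma self_dual_e:
  assumes "finite U" "finite V" "finite U1" "finite V1" "1 \<le> i" "i \<le> n"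
    "e_pair i (U, V) = Some (U1, V1)" "e_pair (2 * n - i) (U1, V1) = Some (U2, V2)"
    "self_dual (2 * n) U V"
  shows "self_dual (2 * n) U2 V2"
  by (rule self_dual_step[where act = e_word and pair_act = e_pair, OF _ _ _ _ assms])
    (fact knuth_eq_e_word e_word_commute e_word_pair e_pair_dual)+

lemma admissible_finite: "admissible n k X Y \<Longrightarrow> finite X \<and> finite Y"
  by (auto simp: admissible_def intro: finite_subset)

lemma dominates_insert:
  assumes "finite U" "finite V" "c \<notin> U" "c \<notin> V"
  shows "dominates (insert c U) (insert c V) \<longleftrightarrow> dominates U V"
  using below_insert[OF assms(1,3)] below_insert[OF assms(2,4)] by (simp add: dominates_def)

text \<open>The letters \<open>n\<close> and \<open>n + 1\<close> carry a string of length two only if both columns contain the one and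
  neither contains the other.\<close>

lemma f_f_middle:
  assumes "f_pair n (U, V) = Some (U1, V1)" "f_pair n (U1, V1) = Some (U2, V2)"
  shows "n \<in> U \<and> n \<in> V \<and> Suc n \<notin> U \<and> Suc n \<notin> V \<and>
    U2 = insert (Suc n) (U - {n}) \<and> V2 = insert (Suc n) (V - {n})"
  using assms unfolding f_pair_eq_Some_iff by auto

lemma e_e_middle:
  assumes "e_pair n (U, V) = Some (U1, V1)" "e_pair n (U1, V1) = Some (U2, V2)"
  shows "Suc n \<in> U \<and> Suc n \<in> V \<and> n \<notin> U \<and> n \<notin> V \<and>
    U2 = insert n (U - {Suc n}) \<and> V2 = insert n (V - {Suc n})"
  using assms unfolding e_pair_eq_Some_iff by auto

text \<open>Self-duality survives by \<open>self_dual_f\<close>. In the upper half, one of the factors acts as an operator on a pair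
  of columns and the other one not at all if \<open>i \<noteq> n\<close>; for \<open>i = n\<close> both columns gain the letter \<open>n + 1\<close>.\<close>

lemma admissible_f:
  assumes adm: "admissible n k X Y" and i: "1 \<le> i" "i \<le> n" and v: "virtual_f n i (pair_word X Y) = Some w'"
  shows "\<exists>X' Y'. w' = pair_word X' Y' \<and> admissible n k X' Y'"
proof -
  have sub: "X \<subseteq> {1..2 * n}" "Y \<subseteq> {1..2 * n}" and fin: "finite X" "finite Y"
    using adm admissible_finite[OF adm] by (auto simp: admissible_def)
  have vf: "virtual_f n i = (\<lambda>w. Option.bind (f_word i w) (f_word (2 * n - i)))"
    by (auto simp: virtual_f_def)
  obtain X1 Y1 where 1: "f_pair i (X, Y) = Some (X1, Y1)"
    and v1: "f_word (2 * n - i) (pair_word X1 Y1) = Some w'"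
    using v fin unfolding vf by (auto simp: f_word_pair bind_eq_Some_conv)
  have fin1: "finite X1" "finite Y1" using f_pair_finite[OF 1 fin] by auto
  obtain X2 Y2 where 2: "f_pair (2 * n - i) (X1, Y1) = Some (X2, Y2)" and w': "w' = pair_word X2 Y2"
    using v1 fin1 by (auto simp: f_word_pair)
  have fin2: "finite X2" "finite Y2" using f_pair_finite[OF 2 fin1] by auto
  have j: "1 \<le> 2 * n - i" "2 * n - i < 2 * n" "i < 2 * n" using i by auto
  have shape1: "X1 \<subseteq> {1..2 * n} \<and> Y1 \<subseteq> {1..2 * n} \<and> card X1 = card X \<and> card Y1 = card Y"
    by (rule f_pair_shape[OF sub i(1) j(3) 1])
  then have shape2: "X2 \<subseteq> {1..2 * n} \<and> Y2 \<subseteq> {1..2 * n} \<and> card X2 = card X1 \<and> card Y2 = card Y1"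
    by (intro f_pair_shape[OF _ _ j(1,2) 2]) auto
  have dom: "dominates X2 Y2"
    using adm by (intro f_pair_dominates[OF fin1 f_pair_dominates[OF fin _ 1] 2]) (simp add: admissible_def)
  have sd: "self_dual (2 * n) X2 Y2"
    using adm by (intro self_dual_f[OF fin fin1 i 1 2]) (simp add: admissible_def)
  have up: "dominates (X \<inter> {n<..}) (Y \<inter> {n<..})" using adm by (simp add: admissible_def)
  have "dominates (X2 \<inter> {n<..}) (Y2 \<inter> {n<..})"
  proof (cases "i = n")
    case False
    then have "2 * n - i \<noteq> n" using i by simp
    then show ?thesis
      by (rule f_pair_dominates_above[OF fin1 f_pair_dominates_above[OF fin up 1 False] 2])
  next
    case True
    with 1 2 have m: "Suc n \<notin> X" "Suc n \<notin> Y" "X2 = insert (Suc n) (X - {n})" "Y2 = insert (Suc n) (Y - {n})"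
      using f_f_middle[of n X Y X1 Y1 X2 Y2] by auto
    then have "X2 \<inter> {n<..} = insert (Suc n) (X \<inter> {n<..})" "Y2 \<inter> {n<..} = insert (Suc n) (Y \<inter> {n<..})"
      by auto
    then show ?thesis using dominates_insert[of "X \<inter> {n<..}" "Y \<inter> {n<..}" "Suc n"] up m fin by simp
  qed
  then show ?thesis using adm w' shape1 shape2 dom sd by (auto simp: admissible_def)
qed

lemma admissible_e:
  assumes adm: "admissible n k X Y" and i: "1 \<le> i" "i \<le> n" and v: "virtual_e n i (pair_word X Y) = Some w'"
  shows "\<exists>X' Y'. w' = pair_word X' Y' \<and> admissible n k X' Y'"
proof -
  have sub: "X \<subseteq> {1..2 * n}" "Y \<subseteq> {1..2 * n}" and fin: "finite X" "finite Y"
    using adm admissible_finite[OF adm] by (auto simp: admissible_def)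
  have ve: "virtual_e n i = (\<lambda>w. Option.bind (e_word i w) (e_word (2 * n - i)))"
    by (auto simp: virtual_e_def)
  obtain X1 Y1 where 1: "e_pair i (X, Y) = Some (X1, Y1)"
    and v1: "e_word (2 * n - i) (pair_word X1 Y1) = Some w'"
    using v fin unfolding ve by (auto simp: e_word_pair bind_eq_Some_conv)
  have fin1: "finite X1" "finite Y1" using e_pair_finite[OF 1 fin] by auto
  obtain X2 Y2 where 2: "e_pair (2 * n - i) (X1, Y1) = Some (X2, Y2)" and w': "w' = pair_word X2 Y2"
    using v1 fin1 by (auto simp: e_word_pair)
  have fin2: "finite X2" "finite Y2" using e_pair_finite[OF 2 fin1] by auto
  have j: "1 \<le> 2 * n - i" "2 * n - i < 2 * n" "i < 2 * n" using i by auto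
  have shape1: "X1 \<subseteq> {1..2 * n} \<and> Y1 \<subseteq> {1..2 * n} \<and> card X1 = card X \<and> card Y1 = card Y"
    by (rule e_pair_shape[OF sub i(1) j(3) 1])
  then have shape2: "X2 \<subseteq> {1..2 * n} \<and> Y2 \<subseteq> {1..2 * n} \<and> card X2 = card X1 \<and> card Y2 = card Y1"
    by (intro e_pair_shape[OF _ _ j(1,2) 2]) auto
  have dom: "dominates X2 Y2"
    using adm by (intro e_pair_dominates[OF fin1 e_pair_dominates[OF fin _ 1] 2]) (simp add: admissible_def)
  have sd: "self_dual (2 * n) X2 Y2"
    using adm by (intro self_dual_e[OF fin fin1 i 1 2]) (simp add: admissible_def)
  have up: "dominates (X \<inter> {n<..}) (Y \<inter> {n<..})" using adm by (simp add: admissible_def)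
  have "dominates (X2 \<inter> {n<..}) (Y2 \<inter> {n<..})"
  proof (cases "i = n")
    case False
    then have "2 * n - i \<noteq> n" using i by simp
    then show ?thesis
      by (rule e_pair_dominates_above[OF fin1 e_pair_dominates_above[OF fin up 1 False] 2])
  next
    case True
    with 1 2 have m: "Suc n \<in> X" "Suc n \<in> Y" "X2 = insert n (X - {Suc n})" "Y2 = insert n (Y - {Suc n})"
      using e_e_middle[of n X Y X1 Y1 X2 Y2] by auto
    then have "X \<inter> {n<..} = insert (Suc n) (X2 \<inter> {n<..})" "Y \<inter> {n<..} = insert (Suc n) (Y2 \<inter> {n<..})"
      by auto
    then show ?thesis using dominates_insert[of "X2 \<inter> {n<..}" "Y2 \<inter> {n<..}" "Suc n"] up m fin2 by simp
  qed
  then show ?thesis using adm w' shape1 shape2 dom sd by (auto simp: admissible_def)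
qed

section \<open>Every admissible tableau is generated from the highest one\<close>

lemma below_initial: "below {1..m} b = min (b - 1) m"
proof -
  have "{1..m} \<inter> {..<b} = {1..<Suc (min (b - 1) m)}" by auto
  then have "below {1..m} b = card {1..<Suc (min (b - 1) m)}" by (simp only: below_def)
  then show ?thesis by simp
qed

lemma dual_initial: "m \<le> N \<Longrightarrow> dual N {1..m} = {1..N - m}"
  by (auto simp: dual_def)

text \<open>The dual of the highest tableau consists of the same two columns in the opposite order.\<close>

lemma initial_swap_knuth_eq:
  assumes "k \<le> m"
  shows "pair_word {1..k} {1..m} \<approx> pair_word {1..m} {1..k}"
proof (rule knuth_eq_pairI)
  have dom: "dominates {1..m} {1..k}" unfolding dominates_def below_initial using assms by auto
  show "dec_below (pair_word {1..k} {1..m}) = dec_below (pair_word {1..m} {1..k})"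
  proof
    fix b
    obtain c where "c \<le> b" "int (dec_below (pair_word {1..k} {1..m}) b) = int (below {1..k} b) - height {1..k} {1..m} c"
      using dec_below_pair_ex[of "{1..k}" "{1..m}" b] by auto
    moreover have "int (below {1..k} b) - height {1..k} {1..m} b \<le> int (dec_below (pair_word {1..k} {1..m}) b)"
      by (rule dec_below_pair_ge) auto
    ultimately have "dec_below (pair_word {1..k} {1..m}) b = below {1..m} b"
      using assms unfolding height_def below_initial by linarith
    then show "dec_below (pair_word {1..k} {1..m}) b = dec_below (pair_word {1..m} {1..k}) b"
      using dec_below_dominates[OF _ _ dom] by simp
  qed
  show "count_list (pair_word {1..k} {1..m}) = count_list (pair_word {1..m} {1..k})"
    by (auto simp: fun_eq_iff)
qed auto

lemma col_initial: "col {1..m} = rev [1..<Suc m]"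
  by (rule col_eqI) (auto simp: sorted_wrt_rev simp del: upt_Suc)

lemma admissible_highest:
  assumes "k \<le> n"
  shows "admissible n k {1..2 * n - k} {1..k}"
proof -
  have "dominates {1..2 * n - k} {1..k}" unfolding dominates_def below_initial using assms by auto
  moreover have "self_dual (2 * n) {1..2 * n - k} {1..k}"
    using initial_swap_knuth_eq[of k "2 * n - k"] assms dual_initial[of k "2 * n"] dual_initial[of "2 * n - k" "2 * n"]
    by (simp add: self_dual_def)
  moreover have "{1..k} \<inter> {n<..} = {}" using assms by auto
  ultimately show ?thesis using assms by (auto simp: admissible_def dominates_def below_def)
qed

lemma V_Lambda_admissible:
  assumes "k \<le> n" "w \<in> V_Lambda n k"
  shows "\<exists>X Y. w = pair_word X Y \<and> admissible n k X Y"
  using assms(2)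
proof induction
  case highest
  have "rev [1..<Suc (2 * n - k)] @ rev [1..<Suc k] = pair_word {1..2 * n - k} {1..k}"
    by (simp only: col_initial)
  then show ?case using admissible_highest[OF assms(1)] by blast
next
  case (f_step w i w')
  then show ?case using admissible_f[of n k _ _ i w'] by auto
next
  case (e_step w i w')
  then show ?case using admissible_e[of n k _ _ i w'] by auto
qed

lemma initial_segment:
  assumes "A \<subseteq> {1..N}" and down: "\<And>i. 1 \<le> i \<Longrightarrow> Suc i \<in> A \<Longrightarrow> i \<in> A"
  shows "A = {1..card A}"
proof (cases "A = {}")
  case False
  have fin: "finite A" using assms(1) finite_subset by blast
  have "x \<in> A" if "1 \<le> x" "x \<le> Max A" for x
    using that(2,1)
  proof (induction rule: inc_induct)
    case base
    then show ?case using fin False by simp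
  next
    case (step m)
    then show ?case using down[of m] by simp
  qed
  then have "A = {1..Max A}" using fin assms(1) by auto
  then show ?thesis by (metis card_atLeastAtMost diff_Suc_1)
qed simp

text \<open>If no \<open>e\<^sub>i\<close> is defined, then \<open>Y\<close> contains \<open>i\<close> with \<open>i + 1\<close>, and so does \<open>X\<close>, except possibly when \<open>i\<close> is in
  \<open>Y\<close> but not in \<open>X\<close>. In that case \<open>Y\<close> has all letters up to \<open>i\<close> and \<open>X\<close> does not, contrary to the tableau condition.
  Hence both columns are initial segments.\<close>

lemma admissible_source:
  assumes adm: "admissible n k X Y" and none: "\<And>i. 1 \<le> i \<Longrightarrow> i < 2 * n \<Longrightarrow> e_word i (pair_word X Y) = None"
  shows "X = {1..2 * n - k} \<and> Y = {1..k}"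
proof -
  have sub: "X \<subseteq> {1..2 * n}" "Y \<subseteq> {1..2 * n}" and fin: "finite X" "finite Y"
    and cards: "card X = 2 * n - k" "card Y = k" and dom: "dominates X Y"
    using adm admissible_finite[OF adm] by (auto simp: admissible_def)
  have none': "e_pair i (X, Y) = None" if "1 \<le> i" "i < 2 * n" for i
    using none[OF that] fin by (simp add: e_word_pair)
  have Y: "i \<in> Y" if "1 \<le> i" "Suc i \<in> Y" for i
  proof -
    have "i < 2 * n" using sub that by auto
    from none'[OF that(1) this] show ?thesis using that(2) by (auto simp: e_pair_def split: if_splits)
  qed
  have Yk: "Y = {1..k}" using initial_segment[OF sub(2) Y] cards by simp
  have X: "i \<in> X" if "1 \<le> i" "Suc i \<in> X" for i
  proof (rule ccontr)
    assume i: "i \<notin> X"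
    have "i < 2 * n" using sub that by auto
    from none'[OF that(1) this] have "i \<in> Y" using that(2) i by (auto simp: e_pair_def split: if_splits)
    then have "below Y (Suc i) = i" using Yk below_initial[of k "Suc i"] by auto
    moreover have "below Y (Suc i) \<le> below X (Suc i)" using dom by (simp add: dominates_def)
    moreover have "below X (Suc i) \<le> below {1..2 * n} i"
      unfolding below_Suc using i sub by (auto simp: below_def intro!: card_mono)
    moreover have "below {1..2 * n} i \<le> i - 1" unfolding below_initial by simp
    ultimately show False using that(1) by simp
  qed
  show ?thesis using initial_segment[OF sub(1) X] cards Yk by simp
qed

lemma self_dual_count:
  assumes "self_dual N U V" "finite U" "finite V"
  shows "count_list (pair_word (dual N U) (dual N V)) a = count_list (pair_word U V) a"
  using knuth_eq_count_list[OF assms(1)[unfolded self_dual_def]] by simp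

text \<open>By self-duality, the letters \<open>n\<close> and \<open>n + 1\<close> occur twice in total. A tableau in the upper half has \<open>n + 1\<close>
  in the second column only if it is also in the first. Among the configurations on which \<open>e\<^sub>n\<close> is defined this
  leaves only the one with \<open>n + 1\<close> in both columns, on which \<open>e\<^sub>n\<close> can be applied twice.\<close>

lemma admissible_middle:
  assumes adm: "admissible n k X Y" and n: "1 \<le> n" and e: "e_word n (pair_word X Y) \<noteq> None"
  shows "virtual_e n n (pair_word X Y) \<noteq> None"
proof -
  have fin: "finite X" "finite Y" using admissible_finite[OF adm] by auto
  have "below (Y \<inter> {n<..}) (Suc (Suc n)) \<le> below (X \<inter> {n<..}) (Suc (Suc n))"
    using adm by (simp add: admissible_def dominates_def)
  moreover have "below (U \<inter> {n<..}) (Suc n) = 0" for U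
    by (auto simp: below_def)
  ultimately have YX: "Suc n \<in> Y \<longrightarrow> Suc n \<in> X" by (auto simp: below_Suc split: if_splits)
  have d: "n \<in> dual (2 * n) U \<longleftrightarrow> Suc n \<notin> U" for U using n by (auto simp: dual_def)
  have "count_list (pair_word (dual (2 * n) X) (dual (2 * n) Y)) n = count_list (pair_word X Y) n"
    using adm fin by (intro self_dual_count) (auto simp: admissible_def)
  then have cnt: "(if Suc n \<notin> X then 1 else 0) + (if Suc n \<notin> Y then 1 else 0) =
      (if n \<in> X then 1 else 0) + (if n \<in> Y then 1 else (0::nat))"
    by (simp only: count_list_append count_list_col fin finite_dual d)
  have "e_pair n (X, Y) \<noteq> None" using e fin by (simp add: e_word_pair)
  then have "Suc n \<in> X" "n \<notin> X" "Suc n \<in> Y" "n \<notin> Y"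
    using YX cnt by (auto simp: e_pair_def split: if_splits)
  then have "e_pair n (X, Y) = Some (insert n (X - {Suc n}), Y)"
    "e_pair n (insert n (X - {Suc n}), Y) = Some (insert n (X - {Suc n}), insert n (Y - {Suc n}))"
    by (auto simp: e_pair_def)
  then show ?thesis using fin by (simp add: virtual_e_def e_word_pair)
qed

text \<open>If \<open>e\<^sub>i\<close> is defined on the pair, then \<open>e\<^sub>2\<^sub>n\<^sub>-\<^sub>i\<close> is defined on its dual, which is Knuth equivalent to the pair.\<close>

lemma self_dual_e_symmetric:
  assumes sd: "self_dual (2 * n) X Y" and fin: "finite X" "finite Y" and i: "1 \<le> i" "i < 2 * n"
    and e: "e_word i (pair_word X Y) \<noteq> None"
  shows "e_word (2 * n - i) (pair_word X Y) \<noteq> None"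
proof -
  have "e_pair i (X, Y) \<noteq> None" using e fin by (simp add: e_word_pair)
  then have "e_pair (2 * n - i) (dual (2 * n) X, dual (2 * n) Y) \<noteq> None" using i by (simp add: e_pair_dual)
  then have "e_word (2 * n - i) (pair_word (dual (2 * n) X) (dual (2 * n) Y)) \<noteq> None" by (simp add: e_word_pair)
  then show ?thesis using knuth_eq_e_word[OF sd[unfolded self_dual_def]] by fastforce
qed

lemma admissible_virtual_e:
  assumes adm: "admissible n k X Y" and i: "1 \<le> i" "i < 2 * n" and e: "e_word i (pair_word X Y) \<noteq> None"
  shows "\<exists>i\<in>{1..n}. virtual_e n i (pair_word X Y) \<noteq> None"
proof -
  have fin: "finite X" "finite Y" using admissible_finite[OF adm] by auto
  have sd: "self_dual (2 * n) X Y" using adm by (simp add: admissible_def)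
  have e': "e_word (2 * n - i) (pair_word X Y) \<noteq> None" by (rule self_dual_e_symmetric[OF sd fin i e])
  have lower: ?thesis
    if j: "1 \<le> j" "j < n" "e_word j (pair_word X Y) \<noteq> None" "e_word (2 * n - j) (pair_word X Y) \<noteq> None" for j
  proof -
    obtain w1 where w1: "e_word j (pair_word X Y) = Some w1" using j by blast
    have "Suc j < 2 * n - j" using j by linarith
    then have "e_word (2 * n - j) w1 \<noteq> None" using e_word_commute_None[OF _ w1, of "2 * n - j"] j by simp
    then have "virtual_e n j (pair_word X Y) \<noteq> None" using w1 j by (simp add: virtual_e_def)
    then show ?thesis using j by (intro bexI[of _ j]) auto
  qed
  consider "i < n" | "i = n" | "n < i" by linarith
  then show ?thesis
  proof cases
    case 1
    then show ?thesis using lower[of i] i e e' by simp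
  next
    case 2
    then show ?thesis using admissible_middle[OF adm] i e by (intro bexI[of _ n]) auto
  next
    case 3
    then have "2 * n - (2 * n - i) = i" "1 \<le> 2 * n - i" "2 * n - i < n" using i by auto
    then show ?thesis using lower[of "2 * n - i"] e e' by simp
  qed
qed

text \<open>The virtual operators apply their two factors in the same order, so inverting one takes a commutation.\<close>

lemma virtual_f_virtual_e:
  assumes "i \<in> {1..n}" "virtual_e n i w = Some w'"
  shows "virtual_f n i w' = Some w"
proof (cases "i = n")
  case True
  then obtain w1 where "e_word n w = Some w1" "e_word n w1 = Some w'"
    using assms(2) by (auto simp: virtual_e_def bind_eq_Some_conv)
  then show ?thesis using True by (simp add: virtual_f_def f_word_e_word)
next
  case False
  then obtain w1 where w1: "e_word i w = Some w1" "e_word (2 * n - i) w1 = Some w'"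
    using assms(2) by (auto simp: virtual_e_def bind_eq_Some_conv)
  have dist: "Suc i < 2 * n - i \<or> Suc (2 * n - i) < i" using False assms(1) by auto
  then have "e_word (2 * n - i) w \<noteq> None" using e_word_commute_None[OF _ w1(1), of "2 * n - i"] w1(2) by simp
  then obtain w2 where w2: "e_word (2 * n - i) w = Some w2" by blast
  then have "e_word i w2 = Some w'" using e_word_commute[OF dist w1(1) w2] w1(2) by auto
  then have "f_word i w' = Some w2" "f_word (2 * n - i) w2 = Some w"
    using w2 by (auto intro: f_word_e_word)
  then show ?thesis using False by (simp add: virtual_f_def)
qed

lemma virtual_e_sum_list:
  assumes "virtual_e n i w = Some w'"
  shows "sum_list w' < sum_list w"
  using assms by (auto simp: virtual_e_def bind_eq_Some_conv split: if_splits dest!: e_word_sum_list)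

text \<open>Virtual lowering operators decrease the sum of the letters, stay among the admissible tableaux and
  are undone by virtual raising operators. They stop only at the generator.\<close>

lemma admissible_V_Lambda:
  assumes "admissible n k X Y"
  shows "pair_word X Y \<in> V_Lambda n k"
  using assms
proof (induction "sum_list (pair_word X Y)" arbitrary: X Y rule: less_induct)
  case less
  show ?case
  proof (cases "\<exists>i. 1 \<le> i \<and> i < 2 * n \<and> e_word i (pair_word X Y) \<noteq> None")
    case False
    then have "X = {1..2 * n - k} \<and> Y = {1..k}" using admissible_source[OF less.prems] by blast
    then show ?thesis using V_Lambda.highest[of n k] by (simp only: col_initial)
  next
    case True
    then obtain i w' where i: "i \<in> {1..n}" "virtual_e n i (pair_word X Y) = Some w'"
      using admissible_virtual_e[OF less.prems] by blast
    then obtain X' Y' where w': "w' = pair_word X' Y'" "admissible n k X' Y'"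
      using admissible_e[OF less.prems _ _ i(2)] i(1) unfolding atLeastAtMost_iff by blast
    have "pair_word X' Y' \<in> V_Lambda n k"
      using virtual_e_sum_list[OF i(2)] w' by (intro less.hyps) auto
    then show ?thesis using V_Lambda.f_step[OF _ i(1) virtual_f_virtual_e[OF i]] w'(1) by simp
  qed
qed

section \<open>Membership in the image of the embeddings\<close>

lemma restrict_word_col:
  assumes "U \<subseteq> {1..2 * n}"
  shows "restrict_word (col U) {n + 1..2 * n} = col (U \<inter> {n<..})"
proof -
  have fin: "finite U" using assms finite_subset by blast
  have "col (U \<inter> {n<..}) = restrict_word (col U) {n + 1..2 * n}"
    using assms fin by (intro col_eqI) (auto simp: restrict_word_def sorted_wrt_filter sorted_col)
  then show ?thesis by simp
qed

text \<open>The dual pair has columns of the sizes required for the image under \<open>\<sigma>\<close>, so it is that image iff it is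
  Knuth equivalent to the pair.\<close>

lemma local_iso_eq_iff:
  assumes sub: "U \<subseteq> {1..2 * n}" "V \<subseteq> {1..2 * n}" and card: "card U = 2 * n - r" "card V = r" and r: "r \<le> n"
  shows "dual_star2 n (col U, col V) = local_iso n r (col U, col V) \<longleftrightarrow> self_dual (2 * n) U V"
proof -
  let ?P = "\<lambda>b'. b' \<in> column_words n r \<times> column_words n (2 * n - r) \<and>
    schensted (pair_word U V) = schensted (fst b' @ snd b')"
  have fin: "finite U" "finite V" using sub finite_subset by blast+
  have uniq: "b = b'" if P: "?P b" "?P b'" for b b'
  proof -
    obtain A B where b: "b = (col A, col B)" "A \<subseteq> {1..2 * n}" "B \<subseteq> {1..2 * n}" "card A = r"
      using P(1) by (auto simp: column_words_eq)
    obtain A' B' where b': "b' = (col A', col B')" "A' \<subseteq> {1..2 * n}" "B' \<subseteq> {1..2 * n}" "card A' = r"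
      using P(2) by (auto simp: column_words_eq)
    have f: "finite A" "finite B" "finite A'" "finite B'" using b b' finite_subset by blast+
    have "schensted (pair_word A B) = schensted (pair_word A' B')" using P b(1) b'(1) by simp
    then have "pair_word A B \<approx> pair_word A' B'" using schensted_eq_iff[OF f] by simp
    then show ?thesis using knuth_eq_same_card[OF f] b b' by simp
  qed
  have "\<exists>b'. ?P b'"
  proof -
    have cards: "card U + card V = 2 * n" "card V \<le> card U" using card r by linarith+
    obtain X Y where XY: "X \<subseteq> {1..2 * n}" "Y \<subseteq> {1..2 * n}" "card X + card Y = 2 * n" "card Y \<le> card V"
      "dominates X Y" "pair_word U V \<approx> pair_word X Y"
      using tableau_reduction[OF sub cards] by (elim exE conjE) (rule that)
    have finX: "finite X" "finite Y" using XY finite_subset by blast+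
    have "card Y \<le> 2 * n - r" "2 * n - r \<le> card X" using XY(3,4) card r by linarith+
    from column_sizes_exist[OF finX XY(5) this] obtain A B where AB: "finite A" "finite B" "A \<union> B = X \<union> Y"
      "card B = 2 * n - r" "card A + (2 * n - r) = card X + card Y" "pair_word A B \<approx> pair_word X Y" by blast
    have "pair_word U V \<approx> pair_word A B" using XY(6) AB(6) by (blast intro: equivclp_trans equivclp_sym)
    moreover have "card A = r" "A \<subseteq> {1..2 * n}" "B \<subseteq> {1..2 * n}" using AB XY r by auto
    ultimately show ?thesis using schensted_eq_iff[OF fin AB(1,2)] AB(4)
      by (intro exI[of _ "(col A, col B)"]) (auto simp: column_words_eq)
  qed
  then have "\<exists>!b'. ?P b'" by (rule ex_ex1I) (rule uniq)
  then have iso: "?P (local_iso n r (col U, col V))"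
    unfolding local_iso_def fst_conv snd_conv by (rule theI')
  have ds: "dual_star2 n (col U, col V) = (col (dual (2 * n) U), col (dual (2 * n) V))"
    using fin by (simp add: dual_star2_def dual_star_col)
  have "card (dual (2 * n) U) = r" "card (dual (2 * n) V) = 2 * n - r"
    using card_dual[OF sub(1)] card_dual[OF sub(2)] card r by auto
  then have "?P (dual_star2 n (col U, col V)) \<longleftrightarrow> schensted (pair_word U V) = schensted (pair_word (dual (2 * n) U) (dual (2 * n) V))"
    using dual_subset unfolding ds column_words_eq by auto
  also have "\<dots> \<longleftrightarrow> self_dual (2 * n) U V"
    using schensted_eq_iff[OF fin, of "dual (2 * n) U" "dual (2 * n) V"]
    by (auto simp: self_dual_def intro: equivclp_sym)
  finally have P_dual: "?P (dual_star2 n (col U, col V)) \<longleftrightarrow> self_dual (2 * n) U V" .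
  show ?thesis
  proof
    assume "dual_star2 n (col U, col V) = local_iso n r (col U, col V)"
    then show "self_dual (2 * n) U V" using iso P_dual by simp
  next
    assume "self_dual (2 * n) U V"
    then have "?P (dual_star2 n (col U, col V))" using P_dual by simp
    then show "dual_star2 n (col U, col V) = local_iso n r (col U, col V)" using iso by (rule uniq)
  qed
qed

lemma iota_eq_iff:
  assumes adm: "admissible n k X Y" and k: "k \<le> r" "r \<le> n"
    and sub: "U \<subseteq> {1..2 * n}" "V \<subseteq> {1..2 * n}" and card: "card U = 2 * n - r" "card V = r"
  shows "iota n r (pair_word X Y) = (col U, col V) \<longleftrightarrow> pair_word U V \<approx> pair_word X Y"
proof -
  let ?P = "\<lambda>b. b \<in> Vhat n r \<and> schensted (fst b @ snd b) = pair_word X Y"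
  have XY: "X \<subseteq> {1..2 * n}" "Y \<subseteq> {1..2 * n}" "card X = 2 * n - k" "card Y = k" "dominates X Y"
    and finX: "finite X" "finite Y"
    using adm admissible_finite[OF adm] by (auto simp: admissible_def)
  have P_iff: "?P (col A, col B) \<longleftrightarrow> pair_word A B \<approx> pair_word X Y"
    if "A \<subseteq> {1..2 * n}" "B \<subseteq> {1..2 * n}" "card A = 2 * n - r" "card B = r" for A B
  proof -
    have f: "finite A" "finite B" using that finite_subset by blast+
    have "(col A, col B) \<in> Vhat n r" using that by (auto simp: Vhat_def column_words_eq)
    moreover have "schensted (pair_word X Y) = pair_word X Y"
      by (rule schensted_pair[OF finX finX XY(5)]) simp
    ultimately show ?thesis using schensted_eq_iff[OF f finX] by simp
  qed
  have P_ex: "\<exists>A B. b = (col A, col B) \<and> A \<subseteq> {1..2 * n} \<and> B \<subseteq> {1..2 * n} \<and> card A = 2 * n - r \<and> card B = r"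
    if "?P b" for b
    using that by (auto simp: Vhat_def column_words_eq)
  have uniq: "b = b'" if P: "?P b" "?P b'" for b b'
  proof -
    obtain A B where b: "b = (col A, col B)" "A \<subseteq> {1..2 * n}" "B \<subseteq> {1..2 * n}" "card A = 2 * n - r" "card B = r"
      using P_ex[OF P(1)] by blast
    obtain A' B' where b': "b' = (col A', col B')" "A' \<subseteq> {1..2 * n}" "B' \<subseteq> {1..2 * n}" "card A' = 2 * n - r" "card B' = r"
      using P_ex[OF P(2)] by blast
    have f: "finite A" "finite B" "finite A'" "finite B'" using b b' finite_subset by blast+
    have "pair_word A B \<approx> pair_word X Y" "pair_word A' B' \<approx> pair_word X Y"
      using P P_iff[OF b(2-)] P_iff[OF b'(2-)] b(1) b'(1) by simp_all
    then have "pair_word A B \<approx> pair_word A' B'" by (blast intro: equivclp_trans equivclp_sym)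
    then show ?thesis using knuth_eq_same_card[OF f] b b' by simp
  qed
  have "card Y \<le> r" "r \<le> card X" using XY(3,4) k by linarith+
  from column_sizes_exist[OF finX XY(5) this] obtain A B where AB: "finite A" "finite B" "A \<union> B = X \<union> Y"
    "card B = r" "card A + r = card X + card Y" "pair_word A B \<approx> pair_word X Y" by blast
  have "card A = 2 * n - r" "A \<subseteq> {1..2 * n}" "B \<subseteq> {1..2 * n}" using AB XY k by auto
  then have "?P (col A, col B)" using P_iff AB by blast
  then have "\<exists>b. ?P b" by (rule exI)
  then have "\<exists>!b. ?P b" by (rule ex_ex1I) (rule uniq)
  then have iota: "?P (iota n r (pair_word X Y))"
    unfolding iota_def by (rule theI')
  show ?thesis
  proof
    assume "iota n r (pair_word X Y) = (col U, col V)"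
    then show "pair_word U V \<approx> pair_word X Y" using iota P_iff[OF sub card] by simp
  next
    assume "pair_word U V \<approx> pair_word X Y"
    then have "?P (col U, col V)" using P_iff[OF sub card] by simp
    with iota show "iota n r (pair_word X Y) = (col U, col V)" by (rule uniq)
  qed
qed

lemma V_sum_iff:
  assumes sub: "U \<subseteq> {1..2 * n}" "V \<subseteq> {1..2 * n}" and card: "card U = 2 * n - r" "card V = r" and r: "r \<le> n"
  shows "(col U, col V) \<in> V_sum n r \<longleftrightarrow>
    self_dual (2 * n) U V \<and> dominates (U \<inter> {n<..}) (V \<inter> {n<..})"
proof -
  have cards: "card U + card V = 2 * n" "card V \<le> card U" using card r by linarith+
  obtain X Y where XY: "X \<subseteq> {1..2 * n}" "Y \<subseteq> {1..2 * n}" "card X + card Y = 2 * n" "card Y \<le> card V"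
    "dominates X Y" "pair_word U V \<approx> pair_word X Y" "self_dual (2 * n) U V \<longleftrightarrow> self_dual (2 * n) X Y"
    "self_dual (2 * n) U V \<longrightarrow> X \<inter> {n<..} = U \<inter> {n<..} \<and> Y \<inter> {n<..} = V \<inter> {n<..}"
    using tableau_reduction[OF sub cards] by (elim exE conjE) (rule that)
  have finX: "finite X" "finite Y" using XY finite_subset by blast+
  have adm: "admissible n (card Y) X Y \<longleftrightarrow> self_dual (2 * n) U V \<and> dominates (U \<inter> {n<..}) (V \<inter> {n<..})"
    using XY by (auto simp: admissible_def)
  have "(col U, col V) \<in> V_sum n r \<longleftrightarrow> admissible n (card Y) X Y"
  proof
    assume "admissible n (card Y) X Y"
    moreover from this have "iota n r (pair_word X Y) = (col U, col V)"
      using iota_eq_iff[OF _ _ r sub card] XY(4,6) card by simp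
    moreover have "card Y \<in> {0..r}" using XY(4) card by simp
    ultimately show "(col U, col V) \<in> V_sum n r"
      unfolding V_sum_def using admissible_V_Lambda by (metis UN_iff image_eqI)
  next
    assume "(col U, col V) \<in> V_sum n r"
    then obtain k t where k: "k \<le> r" "t \<in> V_Lambda n k" "iota n r t = (col U, col V)"
      unfolding V_sum_def by auto
    then obtain X' Y' where t: "t = pair_word X' Y'" "admissible n k X' Y'"
      using V_Lambda_admissible[of k n t] r by auto
    then have "pair_word U V \<approx> pair_word X' Y'" using iota_eq_iff[OF t(2) k(1) r sub card] k(3) by simp
    then have "pair_word X Y \<approx> pair_word X' Y'" using XY(6) by (blast intro: equivclp_trans equivclp_sym)
    moreover have "finite X'" "finite Y'" "dominates X' Y'"
      using t(2) admissible_finite[OF t(2)] by (auto simp: admissible_def)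
    ultimately have "X = X' \<and> Y = Y'" using tableau_unique_knuth[OF finX _ _ XY(5)] by blast
    then show "admissible n (card Y) X Y" using t(2) by (auto simp: admissible_def)
  qed
  then show ?thesis using adm by simp
qed

theorem proposition6p24:
  fixes n r :: nat and u v u2 v2 :: "nat list"
  assumes "1 \<le> n" and "1 \<le> r" and "r \<le> n"
    and "(u, v) \<in> Vhat n r"
    and "u2 = restrict_word u {n + 1..2 * n}"
    and "v2 = restrict_word v {n + 1..2 * n}"
  shows "(u, v) \<in> V_sum n r \<longleftrightarrow>
           dual_star2 n (u, v) = local_iso n r (u, v) \<and>
           columns_tableau u2 v2 \<and>
           int (length u2) - int (length v2) \<ge> int n - int r"
proof -
  obtain U V where U: "u = col U" "U \<subseteq> {1..2 * n}" "card U = 2 * n - r"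
    and V: "v = col V" "V \<subseteq> {1..2 * n}" "card V = r"
    using assms(4) by (auto simp: Vhat_def column_words_eq)
  let ?U2 = "U \<inter> {n<..}" and ?V2 = "V \<inter> {n<..}"
  have fin: "finite U" "finite V" using U V finite_subset by blast+
  have u2: "u2 = col ?U2" and v2: "v2 = col ?V2"
    using assms(5,6) U V restrict_word_col by simp_all
  have tab: "columns_tableau u2 v2 \<longleftrightarrow> dominates ?U2 ?V2"
    using fin by (simp add: u2 v2 columns_tableau_col)
  have upper: "below (A \<inter> {n<..}) b + below A (n + 1) = below A b" if "n + 1 \<le> b" for A b
  proof -
    have "A \<inter> {n<..} \<inter> {..<b} = A \<inter> {n + 1..<b}" by auto
    then show ?thesis using below_interval[OF that, of A] by (simp add: below_def)
  qed
  have excess: "int (length u2) - int (length v2) \<ge> int n - int r"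
    if sd: "self_dual (2 * n) U V" and dom: "dominates ?U2 ?V2"
  proof -
    have "height U V (n + 1) \<le> height U V b" if "n + 1 \<le> b" for b
    proof -
      have "below ?V2 b \<le> below ?U2 b" using dom by (simp add: dominates_def)
      then show ?thesis using upper[OF that, of U] upper[OF that, of V] by (simp add: height_def)
    qed
    then have "height U V (n + 1) \<le> int n - int r"
      using self_dual_upper_excess[OF U(2) V(2) sd] V(3) by simp
    moreover have "below A (2 * n + 1) = card A \<and> below (A \<inter> {n<..}) (2 * n + 1) = card (A \<inter> {n<..})"
      if "A \<subseteq> {1..2 * n}" for A
      using that by (auto intro!: below_large)
    ultimately show ?thesis
      using upper[of "2 * n + 1" U] upper[of "2 * n + 1" V] U V fin assms(3)
      by (simp add: u2 v2 height_def)
  qed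
  show ?thesis
    using V_sum_iff[OF U(2) V(2) U(3) V(3) assms(3)] local_iso_eq_iff[OF U(2) V(2) U(3) V(3) assms(3)] tab excess
    unfolding U(1) V(1) by blast
qed

end
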